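(* Let $n\geq 2$ and let $\psi$ be a bijection of $\mathbb{C}^n$ onto a complex manifold $\mathcal M$ such that $\psi\circ f\circ\psi^{-1}\in E(\mathcal M)$ for every holomorphic map $f:\mathbb{C}^n\to\mathbb{C}^n$. Then $\psi$ is biholomorphic or antibiholomorphic.
   Context: For a complex manifold $\mathcal N$, $E(\mathcal N)$ denotes the semigroup (under composition) of all holomorphic maps $\mathcal N\to\mathcal N$. No continuity of $\psi$ is assumed. *)

theory Defs
  imports "HOL-Analysis.Analysis"
begin

text \<open>Complex n-space is modelled as complex^'n (index type 'n, n = CARD('n)).
A map between complex spaces is holomorphic on S if at each point of S it has a
Frechet derivative which is complex-linear, i.e. given by a complex matrix.\<close>

definition holo_on :: "(complex^'n \<Rightarrow> complex^'m) \<Rightarrow> (complex^'n) set \<Rightarrow> bool" where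
  "holo_on f S \<longleftrightarrow> (\<forall>x\<in>S. \<exists>A :: complex^'n^'m. (f has_derivative (\<lambda>v. A *v v)) (at x))"

definition cnjv :: "complex^'n \<Rightarrow> complex^'n" where
  "cnjv z = (\<chi> i. cnj (z $ i))"

definition complex_chart :: "'M topology \<Rightarrow> ('M set \<times> ('M \<Rightarrow> complex^'m)) \<Rightarrow> bool" where
  "complex_chart T c \<longleftrightarrow> openin T (fst c) \<and> open (snd c ` fst c) \<and>
     homeomorphic_map (subtopology T (fst c)) (subtopology euclidean (snd c ` fst c)) (snd c)"

definition complex_manifold :: "'M topology \<Rightarrow> ('M set \<times> ('M \<Rightarrow> complex^'m)) set \<Rightarrow> bool" where
  "complex_manifold T A \<longleftrightarrow> Hausdorff_space T \<and> second_countable T \<and>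
     (\<forall>c\<in>A. complex_chart T c) \<and> (\<Union>c\<in>A. fst c) = topspace T \<and>
     (\<forall>c\<in>A. \<forall>d\<in>A. holo_on (\<lambda>z. snd d (inv_into (fst c) (snd c) z)) (snd c ` (fst c \<inter> fst d)))"

definition holo_self :: "'M topology \<Rightarrow> ('M set \<times> ('M \<Rightarrow> complex^'m)) set \<Rightarrow> ('M \<Rightarrow> 'M) \<Rightarrow> bool" where
  "holo_self T A g \<longleftrightarrow> continuous_map T T g \<and>
     (\<forall>c\<in>A. \<forall>d\<in>A. holo_on (\<lambda>z. snd d (g (inv_into (fst c) (snd c) z)))
        (snd c ` (fst c \<inter> {p \<in> topspace T. g p \<in> fst d})))"

definition holo_to :: "'M topology \<Rightarrow> ('M set \<times> ('M \<Rightarrow> complex^'m)) set \<Rightarrow> (complex^'n \<Rightarrow> 'M) \<Rightarrow> bool" where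
  "holo_to T A h \<longleftrightarrow> continuous_map euclidean T h \<and> (\<forall>d\<in>A. holo_on (\<lambda>z. snd d (h z)) (h -` fst d))"

definition holo_from :: "'M topology \<Rightarrow> ('M set \<times> ('M \<Rightarrow> complex^'m)) set \<Rightarrow> ('M \<Rightarrow> complex^'n) \<Rightarrow> bool" where
  "holo_from T A k \<longleftrightarrow> continuous_map T euclidean k \<and>
     (\<forall>c\<in>A. holo_on (\<lambda>z. k (inv_into (fst c) (snd c) z)) (snd c ` fst c))"

definition biholo :: "'M topology \<Rightarrow> ('M set \<times> ('M \<Rightarrow> complex^'m)) set \<Rightarrow> (complex^'n \<Rightarrow> 'M) \<Rightarrow> bool" where
  "biholo T A psi \<longleftrightarrow> bij_betw psi UNIV (topspace T) \<and> holo_to T A psi \<and> holo_from T A (inv_into UNIV psi)"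

definition antibiholo :: "'M topology \<Rightarrow> ('M set \<times> ('M \<Rightarrow> complex^'m)) set \<Rightarrow> (complex^'n \<Rightarrow> 'M) \<Rightarrow> bool" where
  "antibiholo T A psi \<longleftrightarrow> biholo T A (psi \<circ> cnjv)"

end

theory Submission
  imports Defs "HOL-Complex_Analysis.Complex_Analysis"
begin

text \<open>Write \<open>phi\<close> for the inverse of \<open>psi\<close>.  If \<open>phi p\<^sub>k\<close> were unbounded along some \<open>p\<^sub>k\<close> converging
  to \<open>x\<close>, a Weierstrass product would give an entire map \<open>f\<close> vanishing at all \<open>phi p\<^sub>k\<close> but not at
  \<open>phi x\<close>; since the conjugate of \<open>f\<close> is continuous, this is absurd.  So \<open>phi\<close> is locally bounded.
  For \<open>z' \<noteq> phi x\<close> a map of exponential type hits \<open>phi x\<close> and omits \<open>z'\<close>; by local boundedness its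
  conjugate is locally injective, hence open by invariance of domain, and this separates \<open>z'\<close> from the
  values of \<open>phi\<close> near \<open>x\<close>.  Thus \<open>phi\<close> is continuous.  By Baire, \<open>psi\<close> is continuous on some ball, and
  then everywhere by conjugating translations.

  The conjugated translations are holomorphic and depend continuously on the translation vector.
  Averaging them against a bump function gives a map \<open>h\<close>, in a chart, with invertible derivative, while
  \<open>h \<circ> psi\<close> is a convolution and hence differentiable; so \<open>psi\<close> is real differentiable.  Its
  derivative at \<open>0\<close> intertwines every complex matrix with a complex matrix, which forces it to be
  complex linear or antilinear.\<close>

subsection \<open>Cauchy estimates for vector valued maps\<close>

lemma norm_scalar_mult_vec: "norm (c *s (v :: complex^'n)) = norm c * norm v"
proof -
  have "norm (c *s v) = sqrt ((norm c)\<^sup>2 * (\<Sum>i\<in>UNIV. (norm (v $ i))\<^sup>2))"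
    by (simp add: norm_vec_def L2_set_def norm_mult power_mult_distrib sum_distrib_left)
  then show ?thesis
    by (simp add: real_sqrt_mult norm_vec_def L2_set_def)
qed

lemma bounded_linear_scalar_mult_vec_left: "bounded_linear (\<lambda>c. c *s (v :: complex^'n))"
  by (rule bounded_linear_intro[where K = "norm v"])
     (auto simp: vec_eq_iff algebra_simps norm_scalar_mult_vec)

lemma linear_matrix_vector_mult_complex: "linear (\<lambda>v. (A :: complex^'n^'m) *v v)"
  by (rule linearI) (auto simp: matrix_vector_mult_def vec_eq_iff algebra_simps sum.distrib
        scaleR_sum_right)

lemma holo_onD:
  assumes "holo_on f S" "x \<in> S"
  obtains A where "(f has_derivative (\<lambda>v. A *v v)) (at x)"
  using assms unfolding holo_on_def by blast

lemma holo_on_subset: "holo_on f S \<Longrightarrow> R \<subseteq> S \<Longrightarrow> holo_on f R"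
  unfolding holo_on_def by blast

lemma holo_on_diff:
  assumes "holo_on f S" "holo_on g S"
  shows "holo_on (\<lambda>x. f x - g x) S"
  unfolding holo_on_def
proof
  fix x assume "x \<in> S"
  then obtain A B where "(f has_derivative (\<lambda>v. A *v v)) (at x)" "(g has_derivative (\<lambda>v. B *v v)) (at x)"
    using assms unfolding holo_on_def by meson
  then have "((\<lambda>x. f x - g x) has_derivative (\<lambda>v. A *v v - B *v v)) (at x)"
    by (rule has_derivative_diff)
  then show "\<exists>A. ((\<lambda>x. f x - g x) has_derivative (\<lambda>v. A *v v)) (at x)"
    by (auto simp: matrix_vector_mult_diff_rdistrib[symmetric])
qed

lemma holo_on_imp_continuous_on: "holo_on f S \<Longrightarrow> continuous_on S f"
  unfolding holo_on_def
  by (meson continuous_at_imp_continuous_on has_derivative_continuous)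

lemma has_field_derivative_along_line:
  fixes f :: "complex^'n \<Rightarrow> complex^'m"
  assumes "(f has_derivative (\<lambda>v. A *v v)) (at (x + t *s e))"
  shows "((\<lambda>t. f (x + t *s e) $ j) has_field_derivative (A *v e) $ j) (at t)"
proof -
  have "((\<lambda>t. x + t *s e) has_derivative (\<lambda>s. s *s e)) (at t)"
    by (auto intro!: derivative_eq_intros bounded_linear_imp_has_derivative
          bounded_linear_scalar_mult_vec_left)
  from has_derivative_compose[OF this assms]
  have "((\<lambda>t. f (x + t *s e)) has_derivative (\<lambda>s. A *v (s *s e))) (at t)" .
  then have "((\<lambda>t. f (x + t *s e) $ j) has_derivative (\<lambda>s. (A *v (s *s e)) $ j)) (at t)"
    by (rule bounded_linear.has_derivative[OF bounded_linear_vec_nth])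
  also have "(\<lambda>s. (A *v (s *s e)) $ j) = (*) ((A *v e) $ j)"
    by (simp add: fun_eq_iff vector_scalar_commute mult.commute)
  finally show ?thesis
    by (simp add: has_field_derivative_def)
qed

lemma norm_le_card_times_bound:
  fixes v :: "complex^'m" and B :: real
  assumes "\<And>j. norm (v $ j) \<le> B"
  shows "norm v \<le> CARD('m) * B"
proof -
  have "norm v \<le> (\<Sum>j\<in>UNIV. norm (v $ j))"
    unfolding norm_vec_def by (rule L2_set_le_sum) simp
  also have "\<dots> \<le> CARD('m) * B"
    using sum_bounded_above[of UNIV "\<lambda>j. norm (v $ j)" B] assms by simp
  finally show ?thesis .
qed

lemma unit_direction:
  fixes y :: "complex^'n"
  assumes "y \<noteq> 0"
  obtains e where "norm e = 1" "y = complex_of_real (norm y) *s e"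
proof
  show "norm (complex_of_real (1 / norm y) *s y) = 1"
    using assms by (simp add: norm_scalar_mult_vec norm_divide)
  show "y = complex_of_real (norm y) *s (complex_of_real (1 / norm y) *s y)"
    using assms by (simp add: vector_smult_assoc)
qed

text \<open>Restricting each coordinate of \<open>f\<close> to the complex line through
  \<open>x\<close> in direction \<open>y\<close> gives a one-variable holomorphic function on a disc
  of radius \<open>R\<close>. Cauchy's inequality for its first two derivatives yields both bounds;
  the factor \<open>CARD('m)\<close> comes from bounding a norm by the sum of the
  coordinates.\<close>

lemma
  fixes f :: "complex^'n \<Rightarrow> complex^'m"
  assumes hol: "holo_on f (ball x R)" and r: "0 < r" "r < R"
    and B: "\<And>y. y \<in> ball x R \<Longrightarrow> norm (f y) \<le> B"
    and A: "(f has_derivative (\<lambda>v. A *v v)) (at x)"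
  shows Cauchy_estimate_vec: "norm (A *v y) \<le> CARD('m) * (B * norm y / r)"
    and Cauchy_Taylor_vec: "norm y \<le> r / 2 \<Longrightarrow>
      norm (f (x + y) - f x - A *v y) \<le> CARD('m) * (8 * B * (norm y)\<^sup>2 / r\<^sup>2)"
proof -
  have B0: "0 \<le> B"
    using B[of x] r by (smt (verit) centre_in_ball norm_ge_zero)
  have "norm (A *v y) \<le> CARD('m) * (B * norm y / r) \<and>
     (norm y \<le> r / 2 \<longrightarrow> norm (f (x + y) - f x - A *v y) \<le> CARD('m) * (8 * B * (norm y)\<^sup>2 / r\<^sup>2))"
  proof (cases "y = 0")
    case True
    then show ?thesis using A B0 r
      by (auto simp: linear_0[OF linear_matrix_vector_mult_complex])
  next
    case False
    then obtain e where e: "norm e = 1" and y: "y = complex_of_real (norm y) *s e"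
      by (rule unit_direction)
    define F where "F j t = f (x + t *s e) $ j" for j t
    have inb: "x + t *s e \<in> ball x R" if "norm t < R" for t
      using that e by (simp add: dist_norm norm_scalar_mult_vec)
    have FB: "norm (F j t) \<le> B" if "norm t < R" for j t
      using B[OF inb[OF that]] Finite_Cartesian_Product.norm_nth_le[of "f (x + t *s e)" j]
      by (simp add: F_def)
    have "\<exists>D. (F j has_field_derivative D) (at t)" if "norm t < R" for j t
      using holo_onD[OF hol inb[OF that]] has_field_derivative_along_line
      unfolding F_def by metis
    then have holF: "F j holomorphic_on ball 0 R" for j
      by (subst holomorphic_on_open) auto
    have contF: "continuous_on S (F j)" if "S \<subseteq> ball 0 R" for S j
      using holF holomorphic_on_imp_continuous_on continuous_on_subset that by blast
    have D0: "deriv (F j) 0 = (A *v e) $ j" for j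
      using has_field_derivative_along_line[of f A x 0 e j] A DERIV_imp_deriv
      unfolding F_def by simp
    have cauchy1: "norm ((A *v e) $ j) \<le> B / r" for j
    proof -
      have "norm ((deriv ^^ 1) (F j) 0) \<le> fact 1 * B / r ^ 1"
        using r by (intro Cauchy_inequality holomorphic_on_subset[OF holF] contF FB) auto
      then show ?thesis by (simp add: D0)
    qed
    have Ay: "(A *v y) $ j = (A *v e) $ j * norm y" for j
      by (subst y) (simp add: vector_scalar_commute)
    have 1: "norm ((A *v y) $ j) \<le> B * norm y / r" for j
      unfolding Ay using mult_right_mono[OF cauchy1[of j], of "norm y"]
      by (simp add: norm_mult)
    moreover have "norm ((f (x + y) - f x - A *v y) $ j) \<le> 8 * B * (norm y)\<^sup>2 / r\<^sup>2"
      if yr: "norm y \<le> r / 2" for j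
    proof -
      \<comment> \<open>The disc of radius \<open>r / 2\<close> around \<open>t\<close> stays inside
        the disc of radius \<open>R\<close>, so Cauchy's inequality with that radius gives
        \<open>fact 2 * B / (r/2) ^ 2\<close>, which is the constant used here.\<close>
      have bd2: "norm ((deriv ^^ 2) (F j) t) \<le> 8 * B / r\<^sup>2" if t: "t \<in> cball 0 (r/2)" for t
      proof -
        have *: "norm s < R" if "norm (t - s) \<le> r/2" for s
          using that t r norm_triangle_ineq2[of s t] by (simp add: norm_minus_commute)
        have sub: "cball t (r/2) \<subseteq> ball 0 R"
          using * by (auto simp: dist_norm)
        have "norm ((deriv ^^ 2) (F j) t) \<le> fact 2 * B / (r/2) ^ 2"
          using r * sub by (intro Cauchy_inequality holomorphic_on_subset[OF holF] contF FB) auto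
        then show ?thesis by (simp add: power_divide)
      qed
      have op: "(deriv ^^ i) (F j) holomorphic_on ball 0 R" for i
        by (rule holomorphic_higher_deriv[OF holF]) auto
      have "norm ((deriv ^^ 0) (F j) (norm y)
          - (\<Sum>i\<le>1. (deriv ^^ i) (F j) 0 * (complex_of_real (norm y) - 0) ^ i / fact i))
          \<le> 8 * B / r\<^sup>2 * norm (complex_of_real (norm y) - 0) ^ Suc 1 / fact 1"
      proof (rule complex_Taylor)
        show "convex (cball (0::complex) (r/2))" by simp
        show "((deriv ^^ i) (F j) has_field_derivative (deriv ^^ Suc i) (F j) t) (at t within cball 0 (r/2))"
          if "t \<in> cball 0 (r/2)" for i t
        proof -
          have "t \<in> ball 0 R" using that r by auto
          then have "((deriv ^^ i) (F j) has_field_derivative deriv ((deriv ^^ i) (F j)) t) (at t)"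
            using op[of i] by (intro holomorphic_derivI[of _ "ball 0 R"]) auto
          then show ?thesis
            by (auto intro: has_field_derivative_at_within)
        qed
        show "norm ((deriv ^^ Suc 1) (F j) t) \<le> 8 * B / r\<^sup>2" if "t \<in> cball 0 (r/2)" for t
          using bd2[OF that] by (simp add: numeral_2_eq_2)
        show "0 \<in> cball (0::complex) (r/2)" "complex_of_real (norm y) \<in> cball 0 (r/2)"
          using yr r by auto
      qed
      moreover have "(f (x + y) - f x - A *v y) $ j
          = F j (norm y) - (F j 0 + deriv (F j) 0 * norm y)"
        using y unfolding F_def[symmetric] D0[unfolded F_def]
        by (simp add: D0 Ay) (simp add: F_def)
      ultimately show ?thesis by (simp add: power2_eq_square)
    qed
    ultimately show ?thesis
      by (intro conjI impI norm_le_card_times_bound)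
  qed
  then show "norm (A *v y) \<le> CARD('m) * (B * norm y / r)"
    "norm y \<le> r / 2 \<Longrightarrow>
      norm (f (x + y) - f x - A *v y) \<le> CARD('m) * (8 * B * (norm y)\<^sup>2 / r\<^sup>2)"
    by blast+
qed

text \<open>Applying \<open>Hi\<close> to the expansion of \<open>h\<close> at \<open>u b\<close>
  bounds \<open>u x - u b\<close> by a small multiple of itself plus a multiple of
  \<open>x - b\<close>. Absorbing the first term makes \<open>u\<close> Lipschitz at
  \<open>b\<close>, and then errors small relative to \<open>u x - u b\<close> are small relative to
  \<open>x - b\<close>.\<close>

lemma has_derivative_from_composition:
  fixes h :: "'a::real_normed_vector \<Rightarrow> 'b::real_normed_vector"
    and u :: "'c::real_normed_vector \<Rightarrow> 'a"
  assumes h: "(h has_derivative H) (at (u b))"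
    and hu: "((\<lambda>x. h (u x)) has_derivative K) (at b)"
    and u: "isCont u b"
    and Hi: "bounded_linear Hi" "\<And>y. Hi (H y) = y"
  shows "(u has_derivative (\<lambda>y. Hi (K y))) (at b)"
proof -
  interpret Hi: bounded_linear Hi by fact
  interpret K: bounded_linear K using hu by (rule has_derivative_bounded_linear)
  obtain c where c: "c > 0" "\<And>y. norm (Hi y) \<le> norm y * c"
    using Hi.pos_bounded by blast
  obtain k where k: "k > 0" "\<And>y. norm (K y) \<le> norm y * k"
    using K.pos_bounded by blast
  have key: "\<exists>d>0. \<forall>x. norm (x - b) < d \<longrightarrow> norm (h (u x) - h (u b) - H (u x - u b)) \<le> e * norm (u x - u b)"
    if e: "e > 0" for e
  proof -
    from h[unfolded has_derivative_at_alt] e obtain d where d: "d > 0"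
      "\<And>y. norm (y - u b) < d \<Longrightarrow> norm (h y - h (u b) - H (y - u b)) \<le> e * norm (y - u b)" by blast
    from u[unfolded continuous_at_eps_delta] d(1) obtain d' where "d' > 0"
      "\<And>x. dist x b < d' \<Longrightarrow> dist (u x) (u b) < d" by blast
    then show ?thesis using d(2) by (intro exI[of _ d']) (auto simp: dist_norm)
  qed
  have key2: "\<exists>d>0. \<forall>x. norm (x - b) < d \<longrightarrow> norm (h (u x) - h (u b) - K (x - b)) \<le> e * norm (x - b)"
    if e: "e > 0" for e
    using hu[unfolded has_derivative_at_alt] e by blast
  \<comment> \<open>The constant is chosen so that after applying \<open>Hi\<close>, of norm at most
    \<open>c\<close>, the error is at most half of \<open>norm (u x - u b)\<close> and can be moved
    to the left.\<close>
  obtain d1 where d1: "d1 > 0" "\<And>x. norm (x - b) < d1 \<Longrightarrow>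
     norm (h (u x) - h (u b) - H (u x - u b)) \<le> 1 / (2 * c) * norm (u x - u b)"
    using key[of "1 / (2*c)"] c by auto
  obtain d2 where d2: "d2 > 0" "\<And>x. norm (x - b) < d2 \<Longrightarrow>
     norm (h (u x) - h (u b) - K (x - b)) \<le> 1 * norm (x - b)"
    using key2[of 1] by auto
  define L where "L = 2 * c * (k + 1)"
  have L0: "L > 0" using c k by (simp add: L_def)
  have split: "u x - u b - Hi (K (x - b)) =
     Hi (h (u x) - h (u b) - K (x - b)) - Hi (h (u x) - h (u b) - H (u x - u b))" for x
    by (simp add: Hi.diff Hi(2))
  have lip: "norm (u x - u b) \<le> L * norm (x - b)" if x: "norm (x - b) < d1" "norm (x - b) < d2" for x
  proof -
    have "norm (u x - u b) = norm (Hi (H (u x - u b)))" by (simp add: Hi(2))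
    also have "\<dots> = norm (Hi (h (u x) - h (u b) - (h (u x) - h (u b) - H (u x - u b))))" by simp
    also have "\<dots> \<le> norm (Hi (h (u x) - h (u b))) + norm (Hi (h (u x) - h (u b) - H (u x - u b)))"
      by (subst Hi.diff) (rule norm_triangle_ineq4)
    also have "\<dots> \<le> norm (h (u x) - h (u b)) * c + (1 / (2 * c) * norm (u x - u b)) * c"
      by (intro add_mono order_trans[OF c(2)] mult_right_mono d1(2) x) (use c in auto)
    also have "\<dots> = norm (h (u x) - h (u b)) * c + norm (u x - u b) / 2" using c by simp
    finally have 1: "norm (u x - u b) \<le> 2 * c * norm (h (u x) - h (u b))" by (simp add: mult_ac)
    have "norm (h (u x) - h (u b)) \<le> norm (h (u x) - h (u b) - K (x - b)) + norm (K (x - b))"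
      by (metis diff_add_cancel norm_triangle_ineq)
    also have "\<dots> \<le> norm (x - b) + norm (x - b) * k"
      using d2(2)[OF x(2)] k(2)[of "x - b"] by simp
    finally have "norm (h (u x) - h (u b)) \<le> (k + 1) * norm (x - b)" by (simp add: algebra_simps)
    with c have "2 * c * norm (h (u x) - h (u b)) \<le> 2 * c * ((k + 1) * norm (x - b))"
      by (intro mult_left_mono) auto
    with 1 show ?thesis by (simp add: L_def algebra_simps)
  qed
  show ?thesis
    unfolding has_derivative_at_alt
  proof (intro conjI allI impI)
    show "bounded_linear (\<lambda>y. Hi (K y))"
      using Hi(1) K.bounded_linear_axioms by (rule bounded_linear_compose)
    fix e :: real assume e: "e > 0"
    obtain d3 where d3: "d3 > 0" "\<And>x. norm (x - b) < d3 \<Longrightarrow>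
       norm (h (u x) - h (u b) - H (u x - u b)) \<le> e / (2 * c * L) * norm (u x - u b)"
      using key[of "e / (2 * c * L)"] c L0 e by auto
    obtain d4 where d4: "d4 > 0" "\<And>x. norm (x - b) < d4 \<Longrightarrow>
       norm (h (u x) - h (u b) - K (x - b)) \<le> e / (2 * c) * norm (x - b)"
      using key2[of "e / (2 * c)"] c e by auto
    show "\<exists>d>0. \<forall>x. norm (x - b) < d \<longrightarrow> norm (u x - u b - Hi (K (x - b))) \<le> e * norm (x - b)"
    proof (intro exI[of _ "min (min d1 d2) (min d3 d4)"] conjI allI impI)
      fix x assume "norm (x - b) < min (min d1 d2) (min d3 d4)"
      then have x: "norm (x - b) < d1" "norm (x - b) < d2" "norm (x - b) < d3" "norm (x - b) < d4" by auto
      have "norm (u x - u b - Hi (K (x - b))) \<le>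
         norm (Hi (h (u x) - h (u b) - K (x - b))) + norm (Hi (h (u x) - h (u b) - H (u x - u b)))"
        unfolding split by (rule norm_triangle_ineq4)
      also have "\<dots> \<le> (e / (2 * c) * norm (x - b)) * c + (e / (2 * c * L) * (L * norm (x - b))) * c"
        by (intro add_mono order_trans[OF c(2)] mult_right_mono d4(2) x order_trans[OF d3(2)]
              mult_left_mono lip) (use c e L0 in auto)
      also have "\<dots> = e * norm (x - b)" using c L0 by (simp add: field_simps)
      finally show "norm (u x - u b - Hi (K (x - b))) \<le> e * norm (x - b)" .
    qed (use d1(1) d2(1) d3(1) d4(1) in auto)
  qed
qed

subsection \<open>Convolution with a bump function\<close>

lemma has_derivative_if_quadratic_remainder:
  assumes L: "bounded_linear L" and d: "d > 0"
    and rem: "\<And>y. norm y \<le> d \<Longrightarrow> norm (f (x + y) - f x - L y) \<le> C * (norm y)\<^sup>2"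
  shows "(f has_derivative L) (at x)"
  unfolding has_derivative_at_alt
proof (intro conjI allI impI L)
  fix e :: real assume e: "e > 0"
  define d' where "d' = min d (e / (\<bar>C\<bar> + 1))"
  show "\<exists>d>0. \<forall>y. norm (y - x) < d \<longrightarrow> norm (f y - f x - L (y - x)) \<le> e * norm (y - x)"
  proof (intro exI[of _ d'] conjI allI impI)
    show "d' > 0" using d e by (auto simp: d'_def)
    fix y assume y: "norm (y - x) < d'"
    have "norm (f y - f x - L (y - x)) \<le> C * (norm (y - x))\<^sup>2"
      using rem[of "y - x"] y by (simp add: d'_def)
    also have "\<dots> \<le> (\<bar>C\<bar> + 1) * norm (y - x) * norm (y - x)"
      unfolding power2_eq_square mult.assoc by (intro mult_right_mono) auto
    also have "\<dots> \<le> e * norm (y - x)"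
      using y by (intro mult_right_mono) (auto simp: d'_def field_simps)
    finally show "norm (f y - f x - L (y - x)) \<le> e * norm (y - x)" .
  qed
qed

text \<open>The squared positive part is continuously differentiable and its derivative
  \<open>2 * max 0 s\<close> has Lipschitz constant 2, whence the quadratic remainder. The proof
  runs through the four sign combinations.\<close>

lemma max_zero_square_Taylor:
  fixes s t :: real
  shows "\<bar>(max 0 t)\<^sup>2 - (max 0 s)\<^sup>2 - 2 * max 0 s * (t - s)\<bar> \<le> (t - s)\<^sup>2"
proof (cases "s \<ge> 0")
  case s: True
  show ?thesis
  proof (cases "t \<ge> 0")
    case True
    then have "(max 0 t)\<^sup>2 - (max 0 s)\<^sup>2 - 2 * max 0 s * (t - s) = (t - s)\<^sup>2"
      using s by (simp add: power2_eq_square algebra_simps)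
    then show ?thesis by simp
  next
    case False
    then have "(max 0 t)\<^sup>2 - (max 0 s)\<^sup>2 - 2 * max 0 s * (t - s) = s * s - 2 * (s * t)"
      using s by (simp add: power2_eq_square algebra_simps)
    moreover have "s * t \<le> 0" using s False by (simp add: mult_nonneg_nonpos)
    then have nn: "0 \<le> s * s - 2 * (s * t)"
      using zero_le_square[of s] by linarith
    have "\<bar>s * s - 2 * (s * t)\<bar> \<le> (t - s)\<^sup>2"
      unfolding abs_of_nonneg[OF nn] by (simp add: power2_eq_square algebra_simps)
    ultimately show ?thesis by (simp only:)
  qed
next
  case s: False
  show ?thesis
  proof (cases "t \<ge> 0")
    case True
    then have "t * t \<le> (t - s) * (t - s)" using s by (intro mult_mono) auto
    then show ?thesis using True s by (simp add: power2_eq_square)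
  next
    case False
    then show ?thesis using s by simp
  qed
qed

text \<open>Squaring the positive part makes the cut-off at radius \<open>r\<close> differentiable,
  with a quadratic first-order remainder. The function is not normalised: its integral is carried
  along as a positive constant.\<close>

definition bump :: "real \<Rightarrow> 'a::euclidean_space \<Rightarrow> real"
  where "bump r a = (max 0 (r\<^sup>2 - (norm a)\<^sup>2))\<^sup>2"

lemma continuous_on_bump: "continuous_on S (bump r)"
  unfolding bump_def by (intro continuous_intros)

lemma bump_nonneg: "0 \<le> bump r a"
  by (simp add: bump_def)

lemma bump_outside:
  assumes "0 < r" "a \<notin> cball 0 r"
  shows "bump r a = 0"
proof -
  have "r\<^sup>2 < (norm a)\<^sup>2" using assms by (intro power_strict_mono) auto
  then show ?thesis by (simp add: bump_def)
qed

lemma integrable_compact_support: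
  fixes w :: "'a::euclidean_space \<Rightarrow> real" and f :: "'a \<Rightarrow> 'b::euclidean_space"
  assumes "compact S" "continuous_on S w" "continuous_on S f" "\<And>a. a \<notin> S \<Longrightarrow> w a = 0"
  shows "integrable lborel (\<lambda>a. w a *\<^sub>R f a)"
proof -
  have "integrable lborel (\<lambda>a. indicator S a *\<^sub>R (w a *\<^sub>R f a))"
    using assms by (intro borel_integrable_compact continuous_intros)
  also have "(\<lambda>a. indicator S a *\<^sub>R (w a *\<^sub>R f a)) = (\<lambda>a. w a *\<^sub>R f a)"
    using assms(4) by (auto simp: fun_eq_iff indicator_def)
  finally show ?thesis .
qed

lemma integrable_bump:
  fixes f :: "'a::euclidean_space \<Rightarrow> 'b::euclidean_space"
  assumes "continuous_on (cball 0 r) f" "0 < r"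
  shows "integrable lborel (\<lambda>a. bump r a *\<^sub>R f a)"
  using assms by (intro integrable_compact_support[OF compact_cball continuous_on_bump _ bump_outside])

lemma bump_integral_pos:
  assumes r: "0 < r"
  shows "0 < (\<integral>a. bump r a \<partial>(lborel :: 'a::euclidean_space measure))"
proof -
  let ?B = "cball (0::'a) (r/2)"
  have int: "integrable lborel (bump r :: 'a \<Rightarrow> real)"
    using integrable_bump[where f = "\<lambda>_. 1::real"] r by simp
  \<comment> \<open>On the ball of half the radius, \<open>r\<^sup>2 - (norm a)\<^sup>2\<close> is
    at least \<open>r\<^sup>2 - (r/2)\<^sup>2\<close>, the factor
    \<open>3 / 4 * r\<^sup>2\<close>.\<close>
  have "0 < (3 / 4 * r\<^sup>2)\<^sup>2 * measure lborel ?B"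
    using r content_cball_pos[of "r/2" "0::'a"] by auto
  also have "\<dots> = (\<integral>a. indicator ?B a *\<^sub>R (3 / 4 * r\<^sup>2)\<^sup>2 \<partial>lborel)"
    using emeasure_bounded_finite[OF bounded_cball, of "0::'a" "r/2"]
    by (simp add: mult.commute)
  also have "\<dots> \<le> (\<integral>a. bump r a \<partial>(lborel :: 'a measure))"
  proof (rule integral_mono[OF _ int])
    show "integrable lborel (\<lambda>a. indicator ?B a *\<^sub>R (3 / 4 * r\<^sup>2)\<^sup>2)"
      by (intro borel_integrable_compact continuous_intros) auto
    fix a :: 'a
    show "indicator ?B a *\<^sub>R (3 / 4 * r\<^sup>2)\<^sup>2 \<le> bump r a"
    proof (cases "a \<in> ?B")
      case True
      then have "(norm a)\<^sup>2 \<le> (r/2)\<^sup>2" by (intro power_mono) auto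
      then have "3 / 4 * r\<^sup>2 \<le> max 0 (r\<^sup>2 - (norm a)\<^sup>2)"
        unfolding le_max_iff_disj by (simp add: power_divide)
      then have "(3 / 4 * r\<^sup>2)\<^sup>2 \<le> bump r a" unfolding bump_def by (intro power_mono) auto
      then show ?thesis using True by simp
    qed (simp add: bump_nonneg)
  qed
  finally show ?thesis .
qed

lemma norm_bump_integral_le:
  fixes f :: "'a::euclidean_space \<Rightarrow> 'b::euclidean_space"
  assumes r: "0 < r" and f: "continuous_on (cball 0 r) f"
    and B: "\<And>a. a \<in> cball 0 r \<Longrightarrow> norm (f a) \<le> B"
  shows "norm (\<integral>a. bump r a *\<^sub>R f a \<partial>lborel) \<le> (\<integral>a. bump r a \<partial>(lborel :: 'a measure)) * B"
proof -
  have "norm (\<integral>a. bump r a *\<^sub>R f a \<partial>lborel) \<le> (\<integral>a. norm (bump r a *\<^sub>R f a) \<partial>lborel)"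
    by (rule integral_norm_bound)
  also have "\<dots> \<le> (\<integral>a. bump r a *\<^sub>R B \<partial>(lborel :: 'a measure))"
  proof (rule integral_mono)
    show "integrable lborel (\<lambda>a. norm (bump r a *\<^sub>R f a))"
      using integrable_bump[OF f r] r by (intro integrable_norm) auto
    show "integrable lborel (\<lambda>a::'a. bump r a *\<^sub>R B)"
      using integrable_bump[where f = "\<lambda>_. B"] r by auto
    show "norm (bump r a *\<^sub>R f a) \<le> bump r a *\<^sub>R B" for a
      using B[of a] bump_outside[OF r, of a] bump_nonneg[of r a]
      by (cases "a \<in> cball 0 r") (auto intro: mult_left_mono)
  qed
  also have "\<dots> = (\<integral>a. bump r a \<partial>(lborel :: 'a measure)) * B"
    by simp
  finally show ?thesis .
qed

text \<open>Translation invariance of Lebesgue measure moves the shift by \<open>b\<close> from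
  \<open>f\<close> to the bump, so that a convolution can be differentiated in \<open>b\<close>
  although \<open>f\<close> is only continuous.\<close>

lemma integral_bump_translate:
  fixes f :: "'a::euclidean_space \<Rightarrow> 'b::euclidean_space"
  assumes "integrable lborel (\<lambda>a. bump r a *\<^sub>R f (a + b))"
  shows "(\<integral>a. bump r a *\<^sub>R f (a + b) \<partial>lborel) = (\<integral>a. bump r (a - b) *\<^sub>R f a \<partial>lborel)"
    and "integrable lborel (\<lambda>a. bump r (a - b) *\<^sub>R f a)"
proof -
  have m1: "(\<lambda>a. bump r a *\<^sub>R f (a + b)) \<in> borel_measurable borel"
    using borel_measurable_integrable[OF assms] by simp
  have "(\<lambda>a. a - b) \<in> borel_measurable borel" by measurable
  from measurable_compose[OF this m1]
  have m: "(\<lambda>a. bump r (a - b) *\<^sub>R f a) \<in> borel_measurable borel"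
    by simp
  have d: "lborel = distr lborel borel ((+) b)" by (simp add: lborel_distr_plus)
  show "(\<integral>a. bump r a *\<^sub>R f (a + b) \<partial>lborel) = (\<integral>a. bump r (a - b) *\<^sub>R f a \<partial>lborel)"
    by (subst (2) d, subst integral_distr) (use m in \<open>auto simp: add.commute\<close>)
  show "integrable lborel (\<lambda>a. bump r (a - b) *\<^sub>R f a)"
    by (subst d, subst integrable_distr_eq) (use m assms in \<open>auto simp: add.commute\<close>)
qed

text \<open>Let \<open>s\<close> and \<open>t\<close> be \<open>r\<^sup>2\<close> minus the squared
  norm at \<open>a\<close> and at \<open>a - b\<close>. For \<open>norm a \<le> 2 * r\<close> one
  has \<open>\<bar>t - s\<bar> \<le> 5 * r * norm b\<close>, which contributes 25 to the constant;
  the other 2 comes from the term \<open>- (norm b)\<^sup>2\<close> in \<open>t - s\<close>. For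
  larger \<open>a\<close> all three terms on the left vanish because
  \<open>norm b \<le> r\<close>.\<close>

lemma bump_Taylor:
  fixes a b :: "'a::euclidean_space"
  assumes r: "0 < r" and b: "norm b \<le> r"
  shows "\<bar>bump r (a - b) - bump r a - 4 * max 0 (r\<^sup>2 - (norm a)\<^sup>2) * (a \<bullet> b)\<bar>
     \<le> indicator (cball 0 (2 * r)) a * (27 * r\<^sup>2 * (norm b)\<^sup>2)"
proof (cases "norm a \<le> 2 * r")
  case True
  define s t where "s = r\<^sup>2 - (norm a)\<^sup>2" and "t = r\<^sup>2 - (norm (a - b))\<^sup>2"
  have ts: "t - s = 2 * (a \<bullet> b) - (norm b)\<^sup>2"
    by (simp add: s_def t_def power2_norm_eq_inner algebra_simps inner_commute)
  have "\<bar>t - s\<bar> \<le> 2 * (norm a * norm b) + norm b * norm b"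
    unfolding ts power2_eq_square
    using Cauchy_Schwarz_ineq2[of a b] zero_le_square[of "norm b"] by linarith
  also have "\<dots> \<le> 2 * (2 * r * norm b) + r * norm b"
    using True b by (intro add_mono mult_left_mono mult_right_mono) auto
  finally have "\<bar>t - s\<bar> \<le> 5 * r * norm b" by simp
  then have "\<bar>t - s\<bar>\<^sup>2 \<le> (5 * r * norm b)\<^sup>2" by (intro power_mono) auto
  then have 1: "(t - s)\<^sup>2 \<le> 25 * r\<^sup>2 * (norm b)\<^sup>2" by (simp add: power_mult_distrib)
  have 2: "2 * max 0 s * (norm b)\<^sup>2 \<le> 2 * r\<^sup>2 * (norm b)\<^sup>2"
    by (intro mult_right_mono mult_left_mono) (auto simp: s_def)
  have 3: "0 \<le> 2 * max 0 s * (norm b)\<^sup>2" by simp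
  have eq: "bump r (a - b) - bump r a - 4 * max 0 s * (a \<bullet> b)
    = ((max 0 t)\<^sup>2 - (max 0 s)\<^sup>2 - 2 * max 0 s * (t - s)) - 2 * max 0 s * (norm b)\<^sup>2"
    unfolding ts by (simp add: bump_def s_def t_def algebra_simps)
  have "\<bar>bump r (a - b) - bump r a - 4 * max 0 s * (a \<bullet> b)\<bar> \<le> 27 * r\<^sup>2 * (norm b)\<^sup>2"
    unfolding eq using max_zero_square_Taylor[of t s] 1 2 3 by linarith
  then show ?thesis using True by (simp add: s_def)
next
  case False
  then have "a \<notin> cball 0 r" "a - b \<notin> cball 0 r"
    using r b norm_triangle_ineq2[of a b] by (auto simp: not_le)
  moreover from this have "r\<^sup>2 < (norm a)\<^sup>2" using r by (intro power_strict_mono) auto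
  ultimately show ?thesis using r False by (simp add: bump_outside)
qed

lemma has_derivative_bump_convolution:
  fixes u :: "'a::euclidean_space \<Rightarrow> 'b::euclidean_space"
  assumes r: "0 < r" and u: "continuous_on (cball 0 (2 * r)) u"
  shows "\<exists>K. ((\<lambda>b. \<integral>a. bump r a *\<^sub>R u (a + b) \<partial>lborel) has_derivative K) (at 0)"
proof -
  let ?S = "cball (0::'a) (2 * r)"
  let ?k = "\<lambda>b. \<integral>a. bump r a *\<^sub>R u (a + b) \<partial>lborel"
  \<comment> \<open>This is the differential at \<open>0\<close>, in direction \<open>b\<close>, of
    \<open>bump r (a - b)\<close> as a function of \<open>b\<close>.\<close>
  define w where "w a b = 4 * max 0 (r\<^sup>2 - (norm a)\<^sup>2) * (a \<bullet> b)" for a b :: 'a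
  define K where "K b = (\<integral>a. w a b *\<^sub>R u a \<partial>lborel)" for b
  have w0: "w a b = 0" if "a \<notin> ?S" for a b
  proof -
    have "r\<^sup>2 < (norm a)\<^sup>2" using that r by (intro power_strict_mono) auto
    then show ?thesis by (simp add: w_def)
  qed
  have intw: "integrable lborel (\<lambda>a. w a b *\<^sub>R u a)" for b
    by (rule integrable_compact_support[of ?S])
       (use w0 u in \<open>auto simp: w_def intro!: continuous_intros\<close>)
  have inta: "integrable lborel (\<lambda>a. bump r a *\<^sub>R u (a + b))" if b: "norm b \<le> r" for b
  proof (rule integrable_bump[OF _ r])
    have "a + b \<in> ?S" if "a \<in> cball 0 r" for a
      using norm_triangle_ineq[of a b] that b by auto
    then show "continuous_on (cball 0 r) (\<lambda>a. u (a + b))"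
      by (intro continuous_on_compose2[OF u] continuous_intros) auto
  qed
  obtain M where M: "M \<ge> 0" "\<And>a. a \<in> ?S \<Longrightarrow> norm (u a) \<le> M"
  proof -
    have "bounded (u ` ?S)"
      using compact_continuous_image[OF u] compact_imp_bounded by auto
    then show ?thesis using that unfolding bounded_pos by (metis imageI less_imp_le)
  qed
  have linK: "linear K"
  proof (rule linearI)
    show "K (b + c) = K b + K c" for b c
      unfolding K_def using intw
      by (subst Bochner_Integration.integral_add[symmetric])
         (auto simp: w_def inner_add_right algebra_simps)
    show "K (t *\<^sub>R b) = t *\<^sub>R K b" for t b
      unfolding K_def by (subst integral_scaleR_right[symmetric]) (simp_all add: w_def mult_ac)
  qed
  have "(?k has_derivative K) (at 0)"
  proof (rule has_derivative_if_quadratic_remainder[where d = r])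
    show "bounded_linear K" using linK by (simp add: linear_conv_bounded_linear)
    fix b :: 'a assume b: "norm b \<le> r"
    have b0: "norm (0::'a) \<le> r" using r by simp
    note tr = integral_bump_translate[OF inta[OF b]]
    have "?k (0 + b) - ?k 0 - K b = (\<integral>a. bump r (a - b) *\<^sub>R u a \<partial>lborel)
        - (\<integral>a. bump r a *\<^sub>R u a \<partial>lborel) - (\<integral>a. w a b *\<^sub>R u a \<partial>lborel)"
      by (simp add: tr(1) K_def)
    also have "\<dots> = (\<integral>a. bump r (a - b) *\<^sub>R u a - bump r a *\<^sub>R u a - w a b *\<^sub>R u a \<partial>lborel)"
      using tr(2) inta[OF b0] intw[of b]
      by (simp add: Bochner_Integration.integral_diff Bochner_Integration.integrable_diff)
    also have "norm \<dots> \<le> (\<integral>a. indicator ?S a *\<^sub>R (27 * r\<^sup>2 * (norm b)\<^sup>2 * M) \<partial>lborel)"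
    proof (rule order_trans[OF integral_norm_bound integral_mono], rule integrable_norm)
      show "integrable lborel (\<lambda>a. bump r (a - b) *\<^sub>R u a - bump r a *\<^sub>R u a - w a b *\<^sub>R u a)"
        using tr(2) inta[OF b0] intw[of b] by (auto intro: Bochner_Integration.integrable_diff)
      show "integrable lborel (\<lambda>a. indicator ?S a *\<^sub>R (27 * r\<^sup>2 * (norm b)\<^sup>2 * M))"
        by (intro borel_integrable_compact continuous_intros) auto
      fix a
      have "norm (bump r (a - b) *\<^sub>R u a - bump r a *\<^sub>R u a - w a b *\<^sub>R u a)
         = \<bar>bump r (a - b) - bump r a - w a b\<bar> * norm (u a)"
        by (simp add: scaleR_diff_left[symmetric])
      also have "\<dots> \<le> indicator ?S a * (27 * r\<^sup>2 * (norm b)\<^sup>2) * norm (u a)"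
        unfolding w_def by (intro mult_right_mono bump_Taylor r b) auto
      also have "\<dots> \<le> indicator ?S a * (27 * r\<^sup>2 * (norm b)\<^sup>2) * M"
        using M by (cases "a \<in> ?S") (auto intro!: mult_left_mono)
      finally show "norm (bump r (a - b) *\<^sub>R u a - bump r a *\<^sub>R u a - w a b *\<^sub>R u a)
         \<le> indicator ?S a *\<^sub>R (27 * r\<^sup>2 * (norm b)\<^sup>2 * M)" by (simp add: mult_ac)
    qed
    also have "\<dots> = (\<integral>a. indicator ?S a *\<^sub>R (27 * r\<^sup>2 * M) \<partial>lborel) * (norm b)\<^sup>2"
      by (subst integral_mult_left_zero[symmetric]) (simp add: mult_ac)
    finally show "norm (?k (0 + b) - ?k 0 - K b)
       \<le> (\<integral>a. indicator ?S a *\<^sub>R (27 * r\<^sup>2 * M) \<partial>lborel) * (norm b)\<^sup>2" .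
  qed (use r in auto)
  then show ?thesis by blast
qed

subsection \<open>Differentiability from conjugated translations\<close>

text \<open>Here \<open>u\<close> stands for the bijection read in a chart, \<open>v\<close> for its
  local inverse, and \<open>G a x = u (a + v x)\<close> for a conjugated translation. The average
  \<open>h\<close> of \<open>G a\<close> over small \<open>a\<close> has an injective derivative at
  \<open>x0\<close>, while \<open>h (u b)\<close> is a convolution of \<open>u\<close>; then
  \<open>has_derivative_from_composition\<close> applies.\<close>

lemma differentiable_if_conjugated_translations_holo:
  fixes u :: "complex^'n \<Rightarrow> complex^'m" and v :: "complex^'m \<Rightarrow> complex^'n"
  assumes V: "open V" "x0 \<in> V" and contv: "continuous_on V v" and v0: "v x0 = 0"
    and W: "open W" and contu: "continuous_on W u"
    and uv: "\<And>x. x \<in> V \<Longrightarrow> v x \<in> W" "\<And>x. x \<in> V \<Longrightarrow> u (v x) = x"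
    and vu: "\<And>b. b \<in> W \<Longrightarrow> v (u b) = b"
    and hol: "\<And>a. holo_on (\<lambda>x. u (a + v x)) {x \<in> V. a + v x \<in> W}"
  shows "\<exists>D. (u has_derivative D) (at 0)"
proof -
  have zW: "0 \<in> W" and u0: "u 0 = x0"
    using uv[of x0] V v0 by auto
  obtain \<rho> where \<rho>: "\<rho> > 0" "cball x0 \<rho> \<subseteq> V"
    using V open_contains_cball by blast
  have contv': "continuous_on (cball x0 \<rho>) v"
    using contv \<rho>(2) continuous_on_subset by blast
  \<comment> \<open>Compactness gives one \<open>\<epsilon>\<close> for all \<open>x\<close> in the
    closed ball, so that \<open>a + v x\<close> stays in \<open>W\<close> for every small
    \<open>a\<close>.\<close>
  have "compact (v ` cball x0 \<rho>)"
    using contv' by (rule compact_continuous_image) simp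
  moreover have "v ` cball x0 \<rho> \<subseteq> W" using \<rho>(2) uv(1) by blast
  ultimately obtain \<epsilon> where \<epsilon>: "\<epsilon> > 0" "(\<Union>y\<in>v ` cball x0 \<rho>. ball y \<epsilon>) \<subseteq> W"
    using compact_subset_open_imp_ball_epsilon_subset W by metis
  define S where "S = cball (0::complex^'n) (\<epsilon> / 2)"
  define G where "G a x = u (a + v x)" for a x
  have inW: "a + v x \<in> W" if "a \<in> S" "x \<in> cball x0 \<rho>" for a x
  proof -
    have "a + v x \<in> ball (v x) \<epsilon>" using that \<epsilon>(1) by (simp add: S_def dist_norm)
    then show ?thesis using \<epsilon>(2) that(2) by blast
  qed
  have contG: "continuous_on (S \<times> cball x0 \<rho>) (\<lambda>z. G (fst z) (snd z))"
    unfolding G_def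
    by (intro continuous_on_compose2[OF contu] continuous_intros continuous_on_compose2[OF contv'])
       (use inW in auto)
  have contGa: "continuous_on S (\<lambda>a. G a x)" if "x \<in> cball x0 \<rho>" for x
    unfolding G_def
    by (intro continuous_on_compose2[OF contu] continuous_intros) (use inW that in auto)
  have "uniformly_continuous_on (S \<times> cball x0 \<rho>) (\<lambda>z. G (fst z) (snd z))"
    using contG by (rule compact_uniformly_continuous) (auto simp: S_def compact_Times)
  then have unif: "\<exists>\<delta>>0. \<forall>a\<in>S. \<forall>a'\<in>S. \<forall>x\<in>cball x0 \<rho>. dist a a' < \<delta> \<longrightarrow> norm (G a x - G a' x) < e"
    if e: "e > 0" for e
  proof -
    obtain d where d: "d > 0" "\<forall>z\<in>S \<times> cball x0 \<rho>. \<forall>z'\<in>S \<times> cball x0 \<rho>. dist z' z < d \<longrightarrow>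
        dist (G (fst z') (snd z')) (G (fst z) (snd z)) < e"
      using \<open>uniformly_continuous_on _ _\<close> e unfolding uniformly_continuous_on_def by blast
    have "norm (G a x - G a' x) < e"
      if "a \<in> S" "a' \<in> S" "x \<in> cball x0 \<rho>" "dist a a' < d" for a a' x
      using d(2)[rule_format, of "(a', x)" "(a, x)"] that by (simp add: dist_Pair_Pair dist_norm)
    then show ?thesis using d(1) by blast
  qed
  define N where "N = real CARD('m)"
  have N: "N \<ge> 1" by (simp add: N_def Suc_leI)
  \<comment> \<open>Chosen so that the Cauchy estimate for \<open>G a x - x\<close> on radius
    \<open>\<rho> / 2\<close> yields exactly the factor \<open>1 / 2\<close>.\<close>
  define \<eta> where "\<eta> = \<rho> / (4 * N)"
  have \<eta>: "\<eta> > 0" using \<rho>(1) N by (simp add: \<eta>_def)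
  obtain \<delta> where \<delta>: "\<delta> > 0"
    "\<And>a a' x. a \<in> S \<Longrightarrow> a' \<in> S \<Longrightarrow> x \<in> cball x0 \<rho> \<Longrightarrow> dist a a' < \<delta> \<Longrightarrow> norm (G a x - G a' x) < \<eta>"
    using unif[OF \<eta>] by blast
  \<comment> \<open>The bound by \<open>\<epsilon> / 4\<close> keeps the ball of radius
    \<open>2 * r\<close> inside \<open>S\<close>, as the convolution lemma requires; the bound by
    \<open>\<delta> / 2\<close> puts \<open>G a\<close> within \<open>\<eta>\<close> of the
    identity.\<close>
  define r where "r = min (\<epsilon> / 4) (\<delta> / 2)"
  have r: "r > 0" "2 * r \<le> \<epsilon> / 2" "r < \<delta>" using \<epsilon>(1) \<delta>(1) by (auto simp: r_def)
  let ?B = "cball (0::complex^'n) r"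
  have BS: "?B \<subseteq> S" using r by (auto simp: S_def)
  have zS: "0 \<in> S" using \<epsilon>(1) by (simp add: S_def)
  have G0: "G 0 x = x" if "x \<in> cball x0 \<rho>" for x
    using \<rho>(2) uv(2) that by (auto simp: G_def)
  have near: "norm (G a x - x) \<le> \<eta>" if "a \<in> ?B" "x \<in> cball x0 \<rho>" for a x
    using \<delta>(2)[of a 0 x] that BS zS r G0[of x] by auto
  have holG: "holo_on (G a) (ball x0 \<rho>)" if "a \<in> S" for a
    unfolding G_def using inW[OF that] \<rho>(2) by (intro holo_on_subset[OF hol]) auto
  have "\<forall>a\<in>S. \<exists>A. (G a has_derivative (\<lambda>v. A *v v)) (at x0)"
    using holG \<rho>(1) unfolding holo_on_def by auto
  then obtain A where A: "\<And>a. a \<in> S \<Longrightarrow> (G a has_derivative (\<lambda>v. A a *v v)) (at x0)"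
    by metis
  have half: "0 < \<rho> / 2" "\<rho> / 2 < \<rho>" using \<rho>(1) by auto
  \<comment> \<open>By uniform continuity \<open>G a' - G a\<close> is uniformly small for close
    parameters, and the Cauchy estimate passes this on to the derivatives at
    \<open>x0\<close>.\<close>
  have contA: "continuous_on S (\<lambda>a. A a *v y)" for y
    unfolding continuous_on_iff
  proof (intro ballI allI impI)
    fix a and e :: real assume a: "a \<in> S" and e: "e > 0"
    define e' where "e' = e * \<rho> / (2 * N * (norm y + 1))"
    have e': "e' > 0" using e \<rho>(1) N by (simp add: e'_def add_nonneg_pos)
    obtain d where d: "d > 0"
      "\<And>a a' x. a \<in> S \<Longrightarrow> a' \<in> S \<Longrightarrow> x \<in> cball x0 \<rho> \<Longrightarrow> dist a a' < d \<Longrightarrow> norm (G a x - G a' x) < e'"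
      using unif[OF e'] by blast
    have "dist (A a' *v y) (A a *v y) < e" if a': "a' \<in> S" "dist a' a < d" for a'
    proof -
      have der: "((\<lambda>x. G a' x - G a x) has_derivative (\<lambda>v. (A a' - A a) *v v)) (at x0)"
        using has_derivative_diff[OF A[OF a'(1)] A[OF a]]
        by (simp add: matrix_vector_mult_diff_rdistrib)
      have "norm ((A a' - A a) *v y) \<le> N * (e' * norm y / (\<rho> / 2))"
        unfolding N_def
      proof (rule Cauchy_estimate_vec[OF holo_on_diff[OF holG[OF a'(1)] holG[OF a]] half _ der])
        fix x assume "x \<in> ball x0 \<rho>"
        then show "norm (G a' x - G a x) \<le> e'"
          using d(2)[OF a'(1) a _ a'(2), of x] by simp
      qed
      also have "\<dots> = e * norm y / (norm y + 1)"
        unfolding e'_def using \<rho>(1) N by simp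
      also have "\<dots> < e"
        using e norm_ge_zero[of y] by (simp add: pos_divide_less_eq add_nonneg_pos)
      finally show ?thesis by (simp add: dist_norm matrix_vector_mult_diff_rdistrib)
    qed
    then show "\<exists>d>0. \<forall>a'\<in>S. dist a' a < d \<longrightarrow> dist (A a' *v y) (A a *v y) < e"
      using d(1) by blast
  qed
  define c where "c = (\<integral>a. bump r a \<partial>(lborel :: (complex^'n) measure))"
  have c: "c > 0" unfolding c_def by (rule bump_integral_pos[OF r(1)])
  define h where "h x = (\<integral>a. bump r a *\<^sub>R G a x \<partial>lborel)" for x
  define H where "H y = (\<integral>a. bump r a *\<^sub>R (A a *v y) \<partial>lborel)" for y
  have contA': "continuous_on ?B (\<lambda>a. A a *v y)" for y
    using contA BS continuous_on_subset by blast
  have contG': "continuous_on ?B (\<lambda>a. G a x)" if "x \<in> cball x0 \<rho>" for x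
    using contGa[OF that] BS continuous_on_subset by blast
  note intA = integrable_bump[OF contA' r(1)]
  note intG = integrable_bump[OF contG' r(1)]
  have linA: "linear (\<lambda>y. A a *v y)" for a
    by (rule linear_matrix_vector_mult_complex)
  have linH: "linear H"
  proof (rule linearI)
    show "H (y + z) = H y + H z" for y z
      unfolding H_def using intA
      by (subst Bochner_Integration.integral_add[symmetric])
         (auto simp: linear_add[OF linA] scaleR_add_right)
    show "H (t *\<^sub>R y) = t *\<^sub>R H y" for t y
      unfolding H_def
      by (subst integral_scaleR_right[symmetric]) (simp_all add: linear_scale[OF linA] mult_ac)
  qed
  \<comment> \<open>Each \<open>A a\<close> with \<open>a\<close> in the support moves
    \<open>y\<close> by at most half its norm, so the average \<open>H\<close> is within
    \<open>c / 2\<close> of \<open>c\<close> times the identity. This forces injectivity.\<close>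
  have Hnear: "norm (H y - c *\<^sub>R y) \<le> c * (norm y / 2)" for y
  proof -
    have "H y - c *\<^sub>R y = (\<integral>a. bump r a *\<^sub>R (A a *v y - y) \<partial>lborel)"
    proof -
      have "integrable lborel (bump r :: complex^'n \<Rightarrow> real)"
        using integrable_bump[where f = "\<lambda>_. 1::real"] r by simp
      then have "c *\<^sub>R y = (\<integral>a. bump r a *\<^sub>R y \<partial>(lborel :: (complex^'n) measure))"
        by (simp add: c_def)
      then show ?thesis
        unfolding H_def scaleR_diff_right
        by (subst Bochner_Integration.integral_diff[OF intA integrable_bump[OF continuous_on_const r(1)]]) simp
    qed
    also have "norm \<dots> \<le> c * (norm y / 2)"
      unfolding c_def
    proof (rule norm_bump_integral_le[OF r(1)])
      show "continuous_on ?B (\<lambda>a. A a *v y - y)" by (intro continuous_intros contA')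
      fix a assume a: "a \<in> ?B"
      then have aS: "a \<in> S" using BS by blast
      have idm: "((\<lambda>x. x) has_derivative (\<lambda>v. (mat 1 :: complex^'m^'m) *v v)) (at x)" for x
        by simp
      have der: "((\<lambda>x. G a x - x) has_derivative (\<lambda>v. (A a - mat 1) *v v)) (at x0)"
        using has_derivative_diff[OF A[OF aS] idm]
        by (simp add: matrix_vector_mult_diff_rdistrib)
      have "holo_on (\<lambda>x. x) (ball x0 \<rho>)"
        using idm unfolding holo_on_def by blast
      note diff = holo_on_diff[OF holG[OF aS] this]
      have "norm ((A a - mat 1) *v y) \<le> N * (\<eta> * norm y / (\<rho> / 2))"
        unfolding N_def
      proof (rule Cauchy_estimate_vec[OF diff half _ der])
        fix x assume "x \<in> ball x0 \<rho>"
        then show "norm (G a x - x) \<le> \<eta>" using near[OF a, of x] by simp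
      qed
      also have "\<dots> = norm y / 2" using \<rho>(1) N by (simp add: \<eta>_def field_simps)
      finally show "norm (A a *v y - y) \<le> norm y / 2"
        by (simp add: matrix_vector_mult_diff_rdistrib)
    qed
    finally show ?thesis .
  qed
  have "inj H"
    unfolding linear_injective_0[OF linH]
  proof (intro allI impI)
    fix y assume "H y = 0"
    then have "norm (0 - c *\<^sub>R y) \<le> c * (norm y / 2)" using Hnear[of y] by simp
    then have "c * norm y \<le> c * (norm y / 2)" using c by simp
    then show "y = 0" using c by simp
  qed
  then obtain Hi where Hi: "linear Hi" "Hi \<circ> H = id"
    using linear_injective_left_inverse[OF linH] by blast
  \<comment> \<open>Differentiation under the integral: all \<open>G a\<close> share the bound
    \<open>M\<close> on the ball, so the Taylor remainder from \<open>Cauchy_Taylor_vec\<close> is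
    quadratic uniformly in \<open>a\<close> and survives averaging.\<close>
  have derh: "(h has_derivative H) (at x0)"
  proof (rule has_derivative_if_quadratic_remainder[where d = "\<rho> / 4"])
    show "bounded_linear H" using linH by (simp add: linear_conv_bounded_linear)
    show "\<rho> / 4 > 0" using \<rho>(1) by simp
    fix y :: "complex^'m" assume y: "norm y \<le> \<rho> / 4"
    have xin: "x0 \<in> cball x0 \<rho>" "x0 + y \<in> cball x0 \<rho>"
      using y \<rho>(1) by (auto simp: dist_norm)
    define M where "M = \<eta> + norm x0 + \<rho>"
    have GM: "norm (G a x) \<le> M" if "a \<in> ?B" "x \<in> ball x0 \<rho>" for a x
    proof -
      have "norm (x - x0) < \<rho>" using that(2) by (simp add: dist_norm norm_minus_commute)
      moreover have "norm (G a x) \<le> norm (G a x - x) + norm x"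
        by (metis diff_add_cancel norm_triangle_ineq)
      moreover have "norm x \<le> norm x0 + norm (x - x0)"
        by (metis add.commute diff_add_cancel norm_triangle_ineq)
      ultimately show ?thesis using near[of a x] that by (auto simp: M_def)
    qed
    have "h (x0 + y) - h x0 - H y
        = (\<integral>a. bump r a *\<^sub>R (G a (x0 + y) - G a x0 - A a *v y) \<partial>lborel)"
      unfolding h_def H_def using intA[of y] intG[OF xin(1)] intG[OF xin(2)]
      unfolding scaleR_diff_right
      by (subst Bochner_Integration.integral_diff | simp | intro Bochner_Integration.integrable_diff)+
    also have "norm \<dots> \<le> c * (N * (8 * M * (norm y)\<^sup>2 / (\<rho> / 2)\<^sup>2))"
      unfolding c_def
    proof (rule norm_bump_integral_le[OF r(1)])
      show "continuous_on ?B (\<lambda>a. G a (x0 + y) - G a x0 - A a *v y)"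
        by (intro continuous_intros contA' contG' xin)
      fix a assume a: "a \<in> ?B"
      then show "norm (G a (x0 + y) - G a x0 - A a *v y) \<le> N * (8 * M * (norm y)\<^sup>2 / (\<rho> / 2)\<^sup>2)"
        unfolding N_def using half BS y
        by (intro Cauchy_Taylor_vec[where R = \<rho>] holG A GM subsetD[OF BS]) auto
    qed
    finally show "norm (h (x0 + y) - h x0 - H y) \<le> c * (N * (8 * M / (\<rho> / 2)\<^sup>2)) * (norm y)\<^sup>2"
      by (simp add: mult_ac)
  qed
  have SW: "cball 0 (2 * r) \<subseteq> W"
  proof
    fix b :: "complex^'n" assume "b \<in> cball 0 (2 * r)"
    then have "b \<in> S" using r by (auto simp: S_def)
    then show "b \<in> W" using inW[of b x0] v0 \<rho>(1) by simp
  qed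
  obtain K where K: "((\<lambda>b. \<integral>a. bump r a *\<^sub>R u (a + b) \<partial>lborel) has_derivative K) (at 0)"
    using has_derivative_bump_convolution[OF r(1) continuous_on_subset[OF contu SW]] by blast
  have "((\<lambda>b. h (u b)) has_derivative K) (at 0)"
  proof (rule has_derivative_transform_eventually[OF K])
    have "eventually (\<lambda>b. b \<in> W) (nhds 0)"
      using W zW by (rule eventually_nhds_in_open)
    then show "eventually (\<lambda>b. (\<integral>a. bump r a *\<^sub>R u (a + b) \<partial>lborel) = h (u b)) (at 0)"
      by (auto simp: eventually_at_filter h_def G_def vu elim: eventually_mono)
    show "(\<integral>a. bump r a *\<^sub>R u (a + 0) \<partial>lborel) = h (u 0)"
      by (simp add: h_def G_def vu zW)
  qed simp
  moreover have "isCont u 0"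
    using contu W zW continuous_on_eq_continuous_at by blast
  ultimately show ?thesis
    using has_derivative_from_composition[of h H u 0 K Hi] derh u0 Hi
    by (auto simp: linear_conv_bounded_linear pointfree_idE)
qed

subsection \<open>Entire maps\<close>

lemma vec_lambda_eq_sum_axis: "(\<chi> j. f j) = (\<Sum>j\<in>UNIV. f j *s axis j (1::complex))"
  by (simp add: vec_eq_iff axis_def if_distrib cong: if_cong)

text \<open>Translations, the Weierstrass test map and the exponential test map below are all of
  this form.\<close>

lemma holo_on_coordinatewise:
  fixes F :: "'n::finite \<Rightarrow> complex \<Rightarrow> complex"
  assumes "\<And>j. F j holomorphic_on UNIV"
  shows "holo_on (\<lambda>w :: complex^'n. \<chi> j. F j (w $ j)) UNIV"
  unfolding holo_on_def
proof
  fix x :: "complex^'n"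
  define D :: "complex^'n^'n" where "D = (\<chi> i k. if i = k then deriv (F i) (x $ i) else 0)"
  have 1: "((\<lambda>w :: complex^'n. F j (w $ j)) has_derivative (\<lambda>v. deriv (F j) (x $ j) * v $ j)) (at x)" for j
  proof -
    have "((\<lambda>w :: complex^'n. w $ j) has_derivative (\<lambda>v. v $ j)) (at x)"
      by (intro bounded_linear_imp_has_derivative bounded_linear_vec_nth)
    moreover have "(F j has_derivative (*) (deriv (F j) (x $ j))) (at (x $ j))"
      using holomorphic_derivI[OF assms[of j] open_UNIV, of "x $ j"] by (simp add: has_field_derivative_def)
    ultimately show ?thesis by (rule has_derivative_compose)
  qed
  have "((\<lambda>w :: complex^'n. \<Sum>j\<in>UNIV. F j (w $ j) *s axis j 1) has_derivative
     (\<lambda>v. \<Sum>j\<in>UNIV. (deriv (F j) (x $ j) * v $ j) *s axis j 1)) (at x)"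
    by (intro has_derivative_sum bounded_linear.has_derivative[OF bounded_linear_scalar_mult_vec_left] 1)
  moreover have "(\<Sum>j\<in>UNIV. (deriv (F j) (x $ j) * v $ j) *s axis j 1) = D *v v" for v
  proof -
    have "D $ i $ k * v $ k = (if i = k then deriv (F i) (x $ i) * v $ i else 0)" for i k
      by (simp add: D_def)
    then show ?thesis
      unfolding vec_lambda_eq_sum_axis[symmetric] by (simp add: vec_eq_iff matrix_vector_mult_def)
  qed
  ultimately have "((\<lambda>w :: complex^'n. \<chi> j. F j (w $ j)) has_derivative (*v) D) (at x)"
    unfolding vec_lambda_eq_sum_axis[symmetric] by (simp only:)
  then show "\<exists>A. ((\<lambda>w :: complex^'n. \<chi> j. F j (w $ j)) has_derivative (*v) A) (at x)" by blast
qed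

lemma holo_on_translation: "holo_on (\<lambda>w. w + a) S"
proof -
  have "holo_on (\<lambda>w. \<chi> j. w $ j + a $ j) UNIV"
    by (rule holo_on_coordinatewise[where F = "\<lambda>j t. t + a $ j"]) (intro holomorphic_intros)
  moreover have "(\<lambda>w. \<chi> j. w $ j + a $ j) = (\<lambda>w. w + a)" by (simp add: fun_eq_iff vec_eq_iff)
  ultimately show ?thesis using holo_on_subset by auto
qed

lemma holo_on_matrix: "holo_on (\<lambda>w. A *v w) S"
  unfolding holo_on_def using linear_matrix_vector_mult_complex[of A]
  by (auto simp: linear_conv_bounded_linear intro: bounded_linear_imp_has_derivative)

text \<open>The growth condition makes \<open>a\<close> tend to infinity, avoid \<open>0\<close> and
  take each value only finitely often, so its Weierstrass product exists. That product vanishes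
  exactly at the points \<open>a k\<close>, hence not at \<open>z\<close>.\<close>

lemma entire_with_zeros:
  assumes a: "\<And>k::nat. norm (a k) > real k" and z: "\<And>k. a k \<noteq> z"
  obtains F where "F holomorphic_on UNIV" "F z \<noteq> 0" "\<And>k. F (a k) = 0"
proof -
  have inf: "filterlim a at_infinity sequentially"
    unfolding filterlim_at_infinity_conv_norm_at_top
    by (rule filterlim_at_top_mono[OF filterlim_real_sequentially]) (use a in \<open>auto intro: less_imp_le always_eventually\<close>)
  interpret weierstrass_product' a
  proof
    show "a n \<noteq> 0" for n using a[of n] by auto
    show "finite (a -` {y})" for y
    proof (rule finite_subset)
      show "a -` {y} \<subseteq> {..nat \<lceil>norm y\<rceil>}"
      proof
        fix k assume "k \<in> a -` {y}"
        then have "real k < norm y" using a[of k] by simp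
        then show "k \<in> {..nat \<lceil>norm y\<rceil>}" by (simp add: le_nat_iff le_ceiling_iff)
      qed
    qed simp
  qed (rule inf)
  show ?thesis
    by (rule that[of f]) (use z in \<open>auto simp: zero holomorphic\<close>)
qed

subsection \<open>Charts and invariance of domain\<close>

locale charted_manifold =
  fixes T :: "'M topology" and A :: "('M set \<times> ('M \<Rightarrow> complex^'m)) set"
  assumes mfd: "complex_manifold T A"
begin

lemma Hausdorff: "Hausdorff_space T" and second_count: "second_countable T"
  and charts: "c \<in> A \<Longrightarrow> complex_chart T c"
  and charts_cover: "(\<Union>c\<in>A. fst c) = topspace T"
  using mfd unfolding complex_manifold_def by auto

lemma obtain_chart:
  assumes "p \<in> topspace T"
  obtains c where "c \<in> A" "p \<in> fst c"
  using assms charts_cover by blast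

text \<open>Meaningful only on \<open>crange c\<close>. It names the \<open>inv_into\<close> term
  that occurs in \<open>holo_self\<close> and \<open>holo_from\<close>, so their chart expressions
  fold into \<open>cinv\<close>.\<close>

definition cinv :: "'M set \<times> ('M \<Rightarrow> complex^'m) \<Rightarrow> complex^'m \<Rightarrow> 'M"
  where "cinv c = inv_into (fst c) (snd c)"

abbreviation crange :: "'M set \<times> ('M \<Rightarrow> complex^'m) \<Rightarrow> (complex^'m) set"
  where "crange c \<equiv> snd c ` fst c"

context
  fixes c assumes c: "c \<in> A"
begin

lemma openin_chart: "openin T (fst c)"
  and open_crange: "open (crange c)"
  and homeo_chart: "homeomorphic_map (subtopology T (fst c)) (top_of_set (crange c)) (snd c)"
  using charts[OF c] unfolding complex_chart_def by auto

lemma chart_subset: "fst c \<subseteq> topspace T"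
  using openin_chart openin_subset by blast

lemma topspace_chart: "topspace (subtopology T (fst c)) = fst c"
  using chart_subset by auto

lemma inj_on_chart: "inj_on (snd c) (fst c)"
  using homeo_chart topspace_chart unfolding homeomorphic_map_def by auto

lemma cinv_chart: "p \<in> fst c \<Longrightarrow> cinv c (snd c p) = p"
  unfolding cinv_def using inj_on_chart by simp

lemma chart_cinv: "x \<in> crange c \<Longrightarrow> snd c (cinv c x) = x"
  unfolding cinv_def by (rule f_inv_into_f)

lemma cinv_in: "x \<in> crange c \<Longrightarrow> cinv c x \<in> fst c"
  unfolding cinv_def by (rule inv_into_into)

lemma continuous_map_chart: "continuous_map (subtopology T (fst c)) euclidean (snd c)"
  using homeomorphic_imp_continuous_map[OF homeo_chart] continuous_map_into_fulltopology by blast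

lemma continuous_map_cinv:
  assumes "S \<subseteq> crange c"
  shows "continuous_map (top_of_set S) T (cinv c)"
proof -
  obtain g where "homeomorphic_maps (subtopology T (fst c)) (top_of_set (crange c)) (snd c) g"
    using homeo_chart homeomorphic_map_maps by blast
  then have g: "continuous_map (top_of_set (crange c)) (subtopology T (fst c)) g"
    and gc: "\<And>p. p \<in> fst c \<Longrightarrow> g (snd c p) = p"
    unfolding homeomorphic_maps_def topspace_chart by auto
  have "continuous_map (top_of_set (crange c)) (subtopology T (fst c)) (cinv c)"
    by (rule continuous_map_eq[OF g]) (auto simp: gc cinv_chart)
  then have "continuous_map (top_of_set (crange c)) T (cinv c)"
    using continuous_map_into_fulltopology by blast
  then show ?thesis
    using assms continuous_map_from_subtopology_mono by blast
qed

lemma continuous_map_compose_chart: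
  assumes "continuous_map X T h" "h ` topspace X \<subseteq> fst c"
  shows "continuous_map X euclidean (\<lambda>x. snd c (h x))"
proof -
  have "continuous_map X (subtopology T (fst c)) h"
    using assms by (auto simp: continuous_map_in_subtopology)
  from continuous_map_compose[OF this continuous_map_chart] show ?thesis by (simp add: o_def)
qed

lemma openin_chart_vimage:
  assumes "open O'"
  shows "openin T {p \<in> fst c. snd c p \<in> O'}"
proof -
  have "openin (subtopology T (fst c)) {p \<in> fst c. snd c p \<in> O'}"
    using openin_continuous_map_preimage[OF continuous_map_chart, of O'] assms
    unfolding topspace_chart by simp
  then show ?thesis using openin_chart by (simp add: openin_open_subtopology)
qed

lemma open_chart_image:
  assumes "openin T N" "N \<subseteq> fst c"
  shows "open (snd c ` N)"
proof -
  have "openin (subtopology T (fst c)) N"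
    using assms openin_chart by (simp add: openin_open_subtopology)
  then have "openin (top_of_set (crange c)) (snd c ` N)"
    using homeomorphic_imp_open_map[OF homeo_chart] unfolding open_map_def by blast
  then show ?thesis using open_crange openin_open_trans by blast
qed

end

lemma openin_preimage:
  assumes "continuous_map T X g" "openin X N" "openin T U"
  shows "openin T {p \<in> U. g p \<in> N}"
proof -
  have "openin T ({p \<in> topspace T. g p \<in> N} \<inter> U)"
    using assms openin_continuous_map_preimage by blast
  also have "{p \<in> topspace T. g p \<in> N} \<inter> U = {p \<in> U. g p \<in> N}"
    using openin_subset[OF assms(3)] by auto
  finally show ?thesis .
qed

text \<open>Openness is checked near each image point. On a neighbourhood mapped from one chart into
  another, \<open>g\<close> becomes a continuous injection between open sets of the same space
  \<open>complex^'m\<close>, and invariance of domain applies.\<close>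

lemma openin_image_if_inj_on:
  assumes g: "continuous_map T T g" and U: "openin T U" and inj: "inj_on g U"
  shows "openin T (g ` U)"
  unfolding openin_subopen[of T "g ` U"]
proof (intro ballI)
  fix y assume "y \<in> g ` U"
  then obtain p where p: "p \<in> U" "y = g p" by blast
  have pT: "p \<in> topspace T" using p U openin_subset by blast
  then have "y \<in> topspace T" using p g unfolding continuous_map_def by auto
  obtain c where c: "c \<in> A" "p \<in> fst c" using obtain_chart[OF pT] .
  obtain d where d: "d \<in> A" "y \<in> fst d" using obtain_chart[OF \<open>y \<in> topspace T\<close>] .
  define N where "N = {q \<in> U \<inter> fst c. g q \<in> fst d}"
  have "openin T N"
    unfolding N_def by (intro openin_preimage[OF g] openin_chart openin_Int U c d)
  then have N: "openin T N" "N \<subseteq> fst c" "N \<subseteq> U" "p \<in> N"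
    using p c d by (auto simp: N_def)
  have op: "open (snd c ` N)" using open_chart_image[OF c(1)] N by blast
  define F where "F x = snd d (g (cinv c x))" for x
  have FN: "F (snd c q) = snd d (g q)" if "q \<in> N" for q
    using that N(2) cinv_chart[OF c(1)] by (auto simp: F_def)
  have im: "g (cinv c x) \<in> fst d" if "x \<in> snd c ` N" for x
    using that N(2) cinv_chart[OF c(1)] by (auto simp: N_def)
  have "continuous_map (top_of_set (snd c ` N)) T (g \<circ> cinv c)"
    using N(2) by (intro continuous_map_compose[OF _ g] continuous_map_cinv c) auto
  then have "continuous_map (top_of_set (snd c ` N)) euclidean F"
    unfolding F_def using im by (intro continuous_map_compose_chart d) (auto simp: o_def)
  then have "continuous_on (snd c ` N) F" by simp
  moreover have "inj_on F (snd c ` N)"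
  proof (rule inj_onI, clarify)
    fix q q' assume q: "q \<in> N" "q' \<in> N" and "F (snd c q) = F (snd c q')"
    then have "g q = g q'"
      using inj_on_chart[OF d(1)] FN by (auto simp: N_def inj_on_def)
    then show "snd c q = snd c q'" using inj q N(3) by (auto simp: inj_on_def)
  qed
  ultimately have "open (F ` snd c ` N)" using op by (intro invariance_of_domain)
  then have "openin T {q \<in> fst d. snd d q \<in> F ` snd c ` N}"
    by (rule openin_chart_vimage[OF d(1)])
  also have "F ` snd c ` N = snd d ` g ` N" using FN by force
  also have "{q \<in> fst d. snd d q \<in> snd d ` g ` N} = g ` N"
    using inj_on_chart[OF d(1)] by (auto simp: N_def inj_on_def)
  finally show "\<exists>R. openin T R \<and> y \<in> R \<and> R \<subseteq> g ` U"
    using N p by blast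
qed

end

subsection \<open>The conjugating bijection is a homeomorphism\<close>

text \<open>Keeping the inverse \<open>phi\<close> as a parameter allows a second instance with
  \<open>psi \<circ> cnjv\<close> and \<open>cnjv \<circ> phi\<close>, which settles the
  antiholomorphic case.\<close>

locale holo_conjugation = charted_manifold T A
  for T :: "'M topology" and A :: "('M set \<times> ('M \<Rightarrow> complex^'m)) set" +
  fixes psi :: "complex^'n \<Rightarrow> 'M" and phi :: "'M \<Rightarrow> complex^'n"
  assumes psi_in [simp]: "psi z \<in> topspace T"
    and phi_psi [simp]: "phi (psi z) = z"
    and psi_phi [simp]: "p \<in> topspace T \<Longrightarrow> psi (phi p) = p"
    and conj: "holo_on f UNIV \<Longrightarrow> holo_self T A (\<lambda>p. psi (f (phi p)))"
begin

definition cj :: "(complex^'n \<Rightarrow> complex^'n) \<Rightarrow> 'M \<Rightarrow> 'M" where "cj f p = psi (f (phi p))"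

lemma psi_eq_iff [simp]: "psi z = psi w \<longleftrightarrow> z = w"
  by (metis phi_psi)

lemma holo_self_cj: "holo_on f UNIV \<Longrightarrow> holo_self T A (cj f)"
  using conj[of f] by (simp add: cj_def[abs_def])

lemma continuous_map_cj: "holo_on f UNIV \<Longrightarrow> continuous_map T T (cj f)"
  using holo_self_cj unfolding holo_self_def by blast

text \<open>While nothing is known about continuity of \<open>phi\<close>, this extracts open sets
  from the hypothesis: \<open>cj f\<close> is continuous and points of a Hausdorff space are
  closed.\<close>

lemma openin_cj_neq:
  fixes z :: "complex^'n"
  assumes "holo_on f UNIV"
  shows "openin T {p \<in> topspace T. f (phi p) \<noteq> z}"
proof -
  have "closedin T {psi z}"
    using Hausdorff by (simp add: closedin_Hausdorff_sing_eq)
  then have "openin T (topspace T - {psi z})" by blast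
  from openin_preimage[OF continuous_map_cj[OF assms] this openin_topspace]
  show ?thesis by (simp add: cj_def cong: conj_cong)
qed

lemma phi_coordinate_locally_bounded:
  assumes x: "x \<in> topspace T"
  shows "\<exists>N B. openin T N \<and> x \<in> N \<and> (\<forall>p\<in>N. norm (phi p $ i) \<le> B)"
proof (rule ccontr)
  assume unbdd: "\<not> ?thesis"
  obtain c where c: "c \<in> A" "x \<in> fst c" using obtain_chart[OF x] .
  define N where "N k = {p \<in> fst c. snd c p \<in> ball (snd c x) (1 / real (Suc k))}" for k
  have "openin T (N k)" for k
    unfolding N_def by (rule openin_chart_vimage[OF c(1)]) simp
  moreover have "x \<in> N k" for k using c by (simp add: N_def)
  \<comment> \<open>The threshold serves twice: the coordinate exceeds \<open>k\<close> in norm, so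
    the sequence tends to infinity, and it exceeds the coordinate of \<open>phi x\<close>, so the
    two differ.\<close>
  ultimately have "\<exists>p\<in>N k. \<not> norm (phi p $ i) \<le> real k + norm (phi x $ i)" for k
    using unbdd by blast
  then obtain p where p: "\<And>k. p k \<in> N k" "\<And>k. \<not> norm (phi (p k) $ i) \<le> real k + norm (phi x $ i)"
    by metis
  have "norm (phi (p k) $ i) > real k" for k using p(2)[of k] by (smt (verit) norm_ge_zero)
  moreover have "phi (p k) $ i \<noteq> phi x $ i" for k using p(2)[of k] by auto
  ultimately obtain F where F: "F holomorphic_on UNIV" "F (phi x $ i) \<noteq> 0" "\<And>k. F (phi (p k) $ i) = 0"
    using entire_with_zeros[of "\<lambda>k. phi (p k) $ i" "phi x $ i"] by auto
  \<comment> \<open>With the other coordinates set to 0, \<open>f\<close> vanishes at every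
    \<open>phi (p k)\<close>, while coordinate \<open>i\<close> keeps it nonzero at
    \<open>phi x\<close>.\<close>
  define f :: "complex^'n \<Rightarrow> complex^'n" where "f w = (\<chi> j. if j = i then F (w $ j) else 0)" for w
  have "(\<lambda>t. if j = i then F t else 0) holomorphic_on UNIV" for j
    by (cases "j = i") (simp_all add: F(1))
  from holo_on_coordinatewise[OF this] have f: "holo_on f UNIV" unfolding f_def[abs_def] .
  define Z where "Z = {q \<in> topspace T. f (phi q) \<noteq> 0} \<inter> fst c"
  have Z: "openin T Z"
    unfolding Z_def by (intro openin_Int openin_cj_neq f openin_chart c)
  have "f (phi x) $ i \<noteq> 0 $ i" using F(2) by (simp add: f_def)
  then have "f (phi x) \<noteq> 0" by metis
  then have "snd c x \<in> snd c ` Z" using x c by (auto simp: Z_def)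
  moreover have "open (snd c ` Z)" by (rule open_chart_image[OF c(1) Z]) (simp add: Z_def)
  ultimately obtain e where e: "e > 0" "ball (snd c x) e \<subseteq> snd c ` Z"
    unfolding open_contains_ball by blast
  obtain k where k: "1 / real (Suc k) < e"
    using e(1) nat_approx_posE by blast
  have "snd c (p k) \<in> snd c ` Z" using p(1)[of k] k e(2) by (auto simp: N_def)
  then have "p k \<in> Z"
    using inj_on_chart[OF c(1)] p(1)[of k] by (auto simp: N_def Z_def inj_on_def)
  moreover have "f (phi (p k)) = 0" using F(3) by (simp add: f_def vec_eq_iff)
  ultimately show False by (simp add: Z_def)
qed

lemma phi_locally_bounded:
  assumes x: "x \<in> topspace T"
  shows "\<exists>N B. openin T N \<and> x \<in> N \<and> (\<forall>p\<in>N. norm (phi p) \<le> B)"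
proof -
  obtain N B where NB: "\<And>i. openin T (N i)" "\<And>i. x \<in> N i" "\<And>i p. p \<in> N i \<Longrightarrow> norm (phi p $ i) \<le> B i"
    using phi_coordinate_locally_bounded[OF x] by metis
  have "openin T (\<Inter>i\<in>UNIV. N i)" using NB(1) by (intro openin_INT2) auto
  moreover have "norm (phi p) \<le> CARD('n) * Max (range B)" if "p \<in> (\<Inter>i\<in>UNIV. N i)" for p
    using that NB(3) by (intro norm_le_card_times_bound) (meson INT_D Max_ge UNIV_I finite finite_imageI
        order_trans rangeI)
  ultimately show ?thesis using NB(2) by blast
qed

text \<open>A map whose \<open>i\<close>-th coordinate is \<open>z' $ i + exp (w $ i)\<close> omits \<open>z'\<close>, while its conjugate is
  locally injective: the deck transformations form a discrete group of fixed point free translations.\<close>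

lemma phi_separates:
  assumes x: "x \<in> topspace T" and z': "z' \<noteq> phi x"
  shows "\<exists>N d. openin T N \<and> x \<in> N \<and> d > 0 \<and> (\<forall>p\<in>N. d \<le> dist z' (phi p))"
proof -
  obtain i where i: "z' $ i \<noteq> phi x $ i" using z' by (auto simp: vec_eq_iff)
  define f :: "complex^'n \<Rightarrow> complex^'n"
    where "f w = (\<chi> j. if j = i then z' $ i + exp (w $ j) else w $ j)" for w
  have "(\<lambda>t. if j = i then z' $ i + exp t else t) holomorphic_on UNIV" for j
    by (cases "j = i") (auto intro!: holomorphic_intros)
  from holo_on_coordinatewise[OF this]
  have f: "holo_on f UNIV" unfolding f_def[abs_def] .
  have omit: "f w \<noteq> z'" for w by (auto simp: f_def vec_eq_iff intro!: exI[of _ i])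
  \<comment> \<open>A preimage of \<open>phi x\<close> under \<open>f\<close>; the logarithm inverts
    \<open>exp\<close> because the \<open>i\<close>-th coordinates of \<open>z'\<close> and
    \<open>phi x\<close> differ.\<close>
  define w0 where "w0 = (\<chi> j. if j = i then Ln (phi x $ i - z' $ i) else phi x $ j)"
  have fw0: "f w0 = phi x" using i by (auto simp: f_def w0_def vec_eq_iff)
  \<comment> \<open>The periods of \<open>f\<close>: two points have the same image exactly when
    they differ by some \<open>\<tau> k\<close>.\<close>
  define \<tau> :: "int \<Rightarrow> complex^'n" where "\<tau> k = axis i (of_int (2 * k) * pi * \<i>)" for k
  define y where "y = psi w0"
  obtain N0 R where N0: "openin T N0" "y \<in> N0" "\<And>p. p \<in> N0 \<Longrightarrow> norm (phi p) \<le> R"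
    using phi_locally_bounded[of y] by (auto simp: y_def)
  \<comment> \<open>Only these nonzero periods can join two points of \<open>N0\<close>, where
    \<open>phi\<close> is bounded by \<open>R\<close>; the crude estimate that \<open>2 * pi\<close>
    is at least 1 suffices. Since \<open>I\<close> is finite, the neighbourhoods excluding each
    period may be intersected.\<close>
  define I where "I = {k::int. k \<noteq> 0 \<and> \<bar>k\<bar> \<le> \<lceil>2 * R\<rceil>}"
  have "I \<subseteq> {- \<lceil>2 * R\<rceil> .. \<lceil>2 * R\<rceil>}" by (auto simp: I_def)
  then have finI: "finite I" using finite_subset by blast
  have "\<exists>U. openin T U \<and> y \<in> U \<and> (\<forall>p\<in>U. \<forall>q\<in>U. phi p \<noteq> phi q + \<tau> k)" if "k \<in> I" for k
  proof -
    \<comment> \<open>The conjugated translation by \<open>\<tau> k\<close> moves \<open>y\<close>.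
      Separating \<open>y\<close> from its image gives a neighbourhood of \<open>y\<close> disjoint
      from its own translate.\<close>
    have "\<tau> k $ i \<noteq> 0" using that by (simp add: \<tau>_def I_def)
    then have "\<tau> k \<noteq> 0" by auto
    then have "cj (\<lambda>w. w + \<tau> k) y \<noteq> y" by (simp add: cj_def y_def)
    moreover have "cj (\<lambda>w. w + \<tau> k) y \<in> topspace T" "y \<in> topspace T" by (simp_all add: cj_def y_def)
    ultimately obtain N1 N2 where N: "openin T N1" "openin T N2" "cj (\<lambda>w. w + \<tau> k) y \<in> N1" "y \<in> N2" "disjnt N1 N2"
      using Hausdorff unfolding Hausdorff_space_def by metis
    show ?thesis
    proof (intro exI[of _ "{p \<in> N2. cj (\<lambda>w. w + \<tau> k) p \<in> N1}"] conjI ballI)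
      show "openin T {p \<in> N2. cj (\<lambda>w. w + \<tau> k) p \<in> N1}"
        using N by (intro openin_preimage[where X = T] continuous_map_cj holo_on_translation) auto
      fix p q assume p: "p \<in> {p \<in> N2. cj (\<lambda>w. w + \<tau> k) p \<in> N1}" and q: "q \<in> {p \<in> N2. cj (\<lambda>w. w + \<tau> k) p \<in> N1}"
      show "phi p \<noteq> phi q + \<tau> k"
      proof
        assume "phi p = phi q + \<tau> k"
        then have "cj (\<lambda>w. w + \<tau> k) q = psi (phi p)" by (simp add: cj_def)
        also have "\<dots> = p" using p openin_subset[OF N(2)] by auto
        finally have "cj (\<lambda>w. w + \<tau> k) q = p" .
        then show False using p q N(5) by (auto simp: disjnt_def)
      qed
    qed (use N in auto)
  qed
  then obtain U where U: "\<And>k. k \<in> I \<Longrightarrow> openin T (U k)" "\<And>k. k \<in> I \<Longrightarrow> y \<in> U k"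
    "\<And>k p q. k \<in> I \<Longrightarrow> p \<in> U k \<Longrightarrow> q \<in> U k \<Longrightarrow> phi p \<noteq> phi q + \<tau> k"
    by metis
  define N1 where "N1 = N0 \<inter> ((\<Inter>k\<in>I. U k) \<inter> topspace T)"
  have N1: "openin T N1" "y \<in> N1"
    using N0 U finI by (auto simp: N1_def y_def)
  have inj: "inj_on (cj f) N1"
  proof (rule inj_onI)
    fix p q assume p: "p \<in> N1" and q: "q \<in> N1" and "cj f p = cj f q"
    then have eq: "f (phi p) = f (phi q)" by (simp add: cj_def)
    have other: "phi p $ j = phi q $ j" if "j \<noteq> i" for j
      using that arg_cong[OF eq, of "\<lambda>v. v $ j"] by (simp add: f_def)
    have "exp (phi p $ i) = exp (phi q $ i)"
      using arg_cong[OF eq, of "\<lambda>v. v $ i"] by (simp add: f_def)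
    then obtain k :: int where k: "phi p $ i = phi q $ i + of_int (2 * k) * pi * \<i>"
      using exp_eq by blast
    have shift: "phi p = phi q + \<tau> k"
      using other k by (auto simp: vec_eq_iff \<tau>_def axis_def)
    have "k = 0"
    proof (rule ccontr)
      assume k0: "k \<noteq> 0"
      have "real_of_int \<bar>k\<bar> * 1 \<le> real_of_int \<bar>k\<bar> * (2 * pi)"
        using pi_gt3 by (intro mult_left_mono) auto
      also have "\<dots> = norm (of_int (2 * k) * complex_of_real pi * \<i>)" by (simp add: norm_mult)
      also have "\<dots> = norm (phi p $ i - phi q $ i)" using k by simp
      also have "\<dots> \<le> norm (phi p $ i) + norm (phi q $ i)" by (rule norm_triangle_ineq4)
      also have "\<dots> \<le> R + R"
      proof (rule add_mono)
        show "norm (phi p $ i) \<le> R" "norm (phi q $ i) \<le> R"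
          using N0(3)[of p] N0(3)[of q] p q Finite_Cartesian_Product.norm_nth_le[of "phi p" i]
            Finite_Cartesian_Product.norm_nth_le[of "phi q" i]
          by (simp_all add: N1_def)
      qed
      finally have "\<bar>k\<bar> \<le> \<lceil>2 * R\<rceil>" by linarith
      then have "k \<in> I" using k0 by (simp add: I_def)
      then show False using U(3) shift p q by (auto simp: N1_def)
    qed
    then have "phi p = phi q" using shift by (simp add: \<tau>_def)
    moreover have "psi (phi p) = p" "psi (phi q) = q" using p q by (simp_all add: N1_def)
    ultimately show "p = q" by metis
  qed
  have "openin T (cj f ` N1)"
    using openin_image_if_inj_on continuous_map_cj f N1 inj by blast
  moreover have "x \<in> cj f ` N1"
    using N1(2) x fw0 by (intro image_eqI[of _ _ y]) (auto simp: cj_def y_def)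
  moreover have "compact (f ` cball 0 R)"
    using continuous_on_subset[OF holo_on_imp_continuous_on[OF f] subset_UNIV]
    by (rule compact_continuous_image) simp
  then obtain d where d: "d > 0" "\<And>v. v \<in> f ` cball 0 R \<Longrightarrow> d \<le> dist z' v"
    using separate_point_closed[of "f ` cball 0 R" z'] omit compact_imp_closed by blast
  have "d \<le> dist z' (phi p)" if p: "p \<in> cj f ` N1" for p
  proof -
    obtain q where "q \<in> N1" "p = cj f q" using p by blast
    then show ?thesis using N0(3)[of q] by (intro d(2)) (auto simp: cj_def N1_def)
  qed
  ultimately show ?thesis using d(1) by blast
qed

text \<open>Near \<open>x\<close> the values of \<open>phi\<close> stay in a fixed ball. The part
  \<open>K\<close> of that ball away from \<open>phi x\<close> is compact, so finitely many balls
  from \<open>phi_separates\<close> cover it, and on a common neighbourhood of \<open>x\<close> all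
  of them are avoided.\<close>

lemma continuous_map_phi: "continuous_map T euclidean phi"
proof -
  have "\<exists>N. openin T N \<and> x \<in> N \<and> phi ` N \<subseteq> ball (phi x) e"
    if x: "x \<in> topspace T" and e: "e > 0" for x e
  proof -
    obtain N0 R where N0: "openin T N0" "x \<in> N0" "\<And>p. p \<in> N0 \<Longrightarrow> norm (phi p) \<le> R"
      using phi_locally_bounded[OF x] by blast
    define K where "K = cball 0 R - ball (phi x) e"
    have K: "compact K" unfolding K_def by (intro compact_diff) auto
    have "z \<noteq> phi x" if "z \<in> K" for z using that e by (auto simp: K_def)
    then have "\<forall>z\<in>K. \<exists>N d. openin T N \<and> x \<in> N \<and> d > 0 \<and> (\<forall>p\<in>N. d \<le> dist z (phi p))"
      by (intro ballI phi_separates x)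
    then obtain N d where Nd: "\<And>z. z \<in> K \<Longrightarrow> openin T (N z)" "\<And>z. z \<in> K \<Longrightarrow> x \<in> N z"
      "\<And>z. z \<in> K \<Longrightarrow> d z > 0" "\<And>z p. z \<in> K \<Longrightarrow> p \<in> N z \<Longrightarrow> d z \<le> dist z (phi p)"
      by metis
    have "K \<subseteq> (\<Union>z\<in>K. ball z (d z))" using Nd(3) by force
    then obtain F where F: "F \<subseteq> K" "finite F" "K \<subseteq> (\<Union>z\<in>F. ball z (d z))"
      using compactE_image[OF K, of K "\<lambda>z. ball z (d z)"] by blast
    define N' where "N' = N0 \<inter> ((\<Inter>z\<in>F. N z) \<inter> topspace T)"
    have "openin T N'" "x \<in> N'"
      unfolding N'_def using N0 Nd F x by (auto intro!: openin_Int openin_INT)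
    moreover have "phi p \<in> ball (phi x) e" if p: "p \<in> N'" for p
    proof (rule ccontr)
      assume "phi p \<notin> ball (phi x) e"
      then have "phi p \<in> K" using N0(3) p by (auto simp: K_def N'_def)
      then obtain z where "z \<in> F" "phi p \<in> ball z (d z)" using F(3) by blast
      moreover from this have "d z \<le> dist z (phi p)"
        using F(1) p by (intro Nd(4)) (auto simp: N'_def)
      ultimately show False by simp
    qed
    ultimately show ?thesis by blast
  qed
  note nbhd = this
  have "openin T {x \<in> topspace T. phi x \<in> O'}" if O': "open O'" for O'
    unfolding openin_subopen[of T "{x \<in> topspace T. phi x \<in> O'}"]
  proof
    fix x assume x: "x \<in> {x \<in> topspace T. phi x \<in> O'}"
    then obtain e where e: "e > 0" "ball (phi x) e \<subseteq> O'"
      using O' open_contains_ball by blast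
    obtain N where N: "openin T N" "x \<in> N" "phi ` N \<subseteq> ball (phi x) e"
      using nbhd[OF _ e(1)] x by blast
    then have "N \<subseteq> {x \<in> topspace T. phi x \<in> O'}"
      using e(2) openin_subset[OF N(1)] by blast
    then show "\<exists>N. openin T N \<and> x \<in> N \<and> N \<subseteq> {x \<in> topspace T. phi x \<in> O'}"
      using N by blast
  qed
  then show ?thesis by (simp add: continuous_map_def)
qed

text \<open>By the Lindelof property countably many chart balls cover the manifold. The images under
  \<open>phi\<close> of the corresponding closed balls are compact and cover
  \<open>complex^'n\<close>, so by Baire one has interior; on it \<open>psi\<close> inverts a
  continuous injection of a compact set.\<close>

lemma psi_continuous_somewhere:
  "\<exists>O'. open O' \<and> O' \<noteq> {} \<and> continuous_map (top_of_set O') T psi"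
proof -
  define P where "P = {(c, y, r). c \<in> A \<and> 0 < r \<and> cball y r \<subseteq> crange c}"
  \<comment> \<open>Open balls give the open cover for Lindelof; the closed balls in
    \<open>C\<close> give compact images for Baire.\<close>
  define nb :: "('M set \<times> ('M \<Rightarrow> complex^'m)) \<times> (complex^'m) \<times> real \<Rightarrow> 'M set"
    where "nb = (\<lambda>(c, y, r). {p \<in> fst c. snd c p \<in> ball y r})"
  define C where "C = (\<lambda>(c, y, r). (\<lambda>x. phi (cinv c x)) ` cball y r)"
  have "\<forall>U \<in> nb ` P. openin T U"
    using openin_chart_vimage[OF _ open_ball] by (auto simp: nb_def P_def simp del: mem_ball)
  moreover have "\<Union>(nb ` P) = topspace T"
  proof (intro equalityI subsetI)
    show "x \<in> topspace T" if "x \<in> \<Union>(nb ` P)" for x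
      using that chart_subset by (fastforce simp: nb_def P_def)
    fix x assume "x \<in> topspace T"
    then obtain c where c: "c \<in> A" "x \<in> fst c" by (rule obtain_chart)
    then obtain r where "r > 0" "cball (snd c x) r \<subseteq> crange c"
      using open_crange[OF c(1)] open_contains_cball by blast
    then have "(c, snd c x, r) \<in> P" "x \<in> nb (c, snd c x, r)" using c by (auto simp: P_def nb_def)
    then show "x \<in> \<Union>(nb ` P)" by blast
  qed
  ultimately obtain \<U> where \<U>: "countable \<U>" "\<U> \<subseteq> nb ` P" "\<Union>\<U> = topspace T"
    using second_countable_imp_Lindelof_space[OF second_count] unfolding Lindelof_space_def by metis
  obtain Q where Q: "countable Q" "Q \<subseteq> P" "\<U> = nb ` Q"
    using \<U>(1,2) by (meson countable_subset_image)
  have cont: "continuous_on (cball y r) (\<lambda>x. phi (cinv c x))" if "(c, y, r) \<in> P" for c y r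
  proof -
    have "continuous_map (top_of_set (cball y r)) euclidean (phi \<circ> cinv c)"
      using that by (intro continuous_map_compose[OF continuous_map_cinv continuous_map_phi])
        (auto simp: P_def)
    then show ?thesis by (simp add: o_def)
  qed
  have cl: "closed (C q)" if q: "q \<in> Q" for q
  proof (cases q)
    case (fields c y r)
    then have "compact (C q)"
      unfolding C_def using cont[of c y r] q Q(2) by (auto intro!: compact_continuous_image)
    then show ?thesis by (rule compact_imp_closed)
  qed
  have cover: "\<Union>(C ` Q) = UNIV"
  proof -
    have "z \<in> \<Union>(C ` Q)" for z
    proof -
      obtain q where q: "q \<in> Q" "psi z \<in> nb q"
        using \<U>(3) Q(3) psi_in[of z] by blast
      obtain c y r where cyr: "q = (c, y, r)" by (cases q)
      have "c \<in> A" using q Q(2) cyr by (auto simp: P_def)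
      then have "z = phi (cinv c (snd c (psi z)))" "snd c (psi z) \<in> cball y r"
        using q cyr cinv_chart by (auto simp: nb_def)
      then have "z \<in> C q" unfolding C_def cyr prod.case by (rule image_eqI)
      then show ?thesis using q by blast
    qed
    then show ?thesis by blast
  qed
  have "\<exists>q\<in>Q. interior (C q) \<noteq> {}"
  proof (rule ccontr)
    assume "\<not> ?thesis"
    then have "euclidean interior_of \<Union>(C ` Q) = {}"
      using Q(1) cl completely_metrizable_space_euclidean
      by (intro Baire_category_alt) auto
    then show False unfolding cover by simp
  qed
  then obtain c y r where q: "(c, y, r) \<in> P" and ne: "interior (C (c, y, r)) \<noteq> {}"
    using Q(2) by (metis prod_cases3 subsetD)
  have c: "c \<in> A" "cball y r \<subseteq> crange c" using q by (auto simp: P_def)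
  let ?k = "\<lambda>z. snd c (psi z)"
  have inv: "?k (phi (cinv c x)) = x" if "x \<in> cball y r" for x
    using that c cinv_in[OF c(1)] chart_cinv[OF c(1)] chart_subset[OF c(1)] by (metis psi_phi subsetD)
  have k: "continuous_on (C (c, y, r)) ?k"
    unfolding C_def prod.case using cont[OF q] inv by (intro continuous_on_inv) auto
  have kC: "?k z \<in> cball y r \<and> psi z = cinv c (?k z)" if "z \<in> C (c, y, r)" for z
  proof -
    obtain x where "x \<in> cball y r" "z = phi (cinv c x)"
      using \<open>z \<in> C (c, y, r)\<close> unfolding C_def prod.case by blast
    moreover from this have "psi z = cinv c x"
      using c(2) cinv_in[OF c(1), of x] chart_subset[OF c(1)] psi_phi by blast
    ultimately show ?thesis using inv by metis
  qed
  have "continuous_map (top_of_set (C (c, y, r))) (top_of_set (cball y r)) ?k"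
    using k kC by (auto simp: continuous_map_in_subtopology)
  from continuous_map_compose[OF this continuous_map_cinv[OF c]]
  have "continuous_map (top_of_set (C (c, y, r))) T psi"
    by (rule continuous_map_eq) (use kC in auto)
  then have "continuous_map (top_of_set (interior (C (c, y, r)))) T psi"
    using interior_subset continuous_map_from_subtopology_mono by blast
  then show ?thesis using ne open_interior by blast
qed

text \<open>Near \<open>z\<close>, \<open>psi\<close> is the translation to \<open>z0\<close>,
  followed by \<open>psi\<close> near \<open>z0\<close>, followed by the continuous conjugate of the
  translation back.\<close>

lemma continuous_map_psi: "continuous_map euclidean T psi"
proof -
  obtain O' z0 where O': "open O'" "z0 \<in> O'" "continuous_map (top_of_set O') T psi"
    using psi_continuous_somewhere by blast
  have "open (psi -` N)" if N: "openin T N" for N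
    unfolding open_subopen[of "psi -` N"]
  proof
    fix z assume z: "z \<in> psi -` N"
    define t where "t = cj (\<lambda>w. w + (z - z0))"
    have tpsi: "t (psi w) = psi (w + (z - z0))" for w by (simp add: t_def cj_def)
    have "continuous_map (top_of_set O') T (t \<circ> psi)"
      unfolding t_def
      by (intro continuous_map_compose[OF O'(3)] continuous_map_cj holo_on_translation)
    from openin_continuous_map_preimage[OF this N]
    have "openin (top_of_set O') {w \<in> O'. t (psi w) \<in> N}" by simp
    then have "open {w \<in> O'. t (psi w) \<in> N}" using O'(1) openin_open_trans by blast
    then have "open ((\<lambda>w. (z - z0) + w) ` {w \<in> O'. t (psi w) \<in> N})" by (rule open_translation)
    moreover have "z \<in> (\<lambda>w. (z - z0) + w) ` {w \<in> O'. t (psi w) \<in> N}"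
      using O'(2) z by (intro image_eqI[of _ _ z0]) (auto simp: tpsi)
    moreover have "(\<lambda>w. (z - z0) + w) ` {w \<in> O'. t (psi w) \<in> N} \<subseteq> psi -` N"
      by (auto simp: tpsi add.commute)
    ultimately show "\<exists>S. open S \<and> z \<in> S \<and> S \<subseteq> psi -` N" by blast
  qed
  then show ?thesis by (auto simp: continuous_map_def vimage_def)
qed

end

subsection \<open>Real linear maps intertwining complex matrices\<close>

lemma mat_imaginary_unit: "mat \<i> *v y = \<i> *s (y :: complex^'n)"
proof -
  have "(mat \<i> :: complex^'n^'n) $ i $ j * y $ j = (if i = j then \<i> * y $ i else 0)" for i j
    by (simp add: mat_def)
  then show ?thesis by (simp add: vec_eq_iff matrix_vector_mult_def)
qed

text \<open>A matrix with a single nonzero column suffices. Consequently a subspace invariant under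
  all square matrices is zero or everything.\<close>

lemma matrix_maps_to:
  fixes y :: "complex^'n" and w :: "complex^'m"
  assumes "y \<noteq> 0"
  obtains B where "B *v y = w"
proof -
  obtain k where k: "y $ k \<noteq> 0" using assms by (auto simp: vec_eq_iff)
  define B :: "complex^'n^'m" where "B = (\<chi> i j. if j = k then w $ i / y $ k else 0)"
  have "B $ i $ j * y $ j = (if j = k then w $ i else 0)" for i j
    using k by (simp add: B_def)
  then have "B *v y = w" by (simp add: vec_eq_iff matrix_vector_mult_def)
  then show thesis by (rule that)
qed

text \<open>The map \<open>D \<circ> \<i> \<circ> inv D\<close> is complex linear with square \<open>- 1\<close>; its eigenspaces for \<open>\<i>\<close> and
  \<open>- \<i>\<close> correspond under \<open>D\<close> to subspaces invariant under all matrices, so one of them is everything.\<close>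

lemma complex_linear_or_antilinear:
  fixes D :: "complex^'n \<Rightarrow> complex^'m"
  assumes D: "linear D" "surj D"
    and ex: "\<And>B :: complex^'n^'n. \<exists>M. \<forall>y. D (B *v y) = M *v D y"
  shows "(\<forall>y. D (\<i> *s y) = \<i> *s D y) \<or> (\<forall>y. D (\<i> *s y) = - (\<i> *s D y))"
proof (cases "\<exists>y. y \<noteq> 0 \<and> D (\<i> *s y) = \<i> *s D y")
  case True
  then obtain y where y: "y \<noteq> 0" "D (\<i> *s y) = \<i> *s D y" by blast
  have "D (\<i> *s w) = \<i> *s D w" for w
  proof -
    obtain B :: "complex^'n^'n" where B: "B *v y = w" using matrix_maps_to[OF y(1)] .
    obtain M where M: "\<And>y. D (B *v y) = M *v D y" using ex by blast
    have "D (\<i> *s w) = D (B *v (\<i> *s y))" by (simp add: vector_scalar_commute B)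
    also have "\<dots> = M *v D (\<i> *s y)" by (rule M)
    also have "\<dots> = \<i> *s (M *v D y)" by (simp add: y(2) vector_scalar_commute)
    also have "\<dots> = \<i> *s D w" by (simp add: M[symmetric] B)
    finally show ?thesis .
  qed
  then show ?thesis by blast
next
  case False
  obtain N where "\<And>y. D (mat \<i> *v y) = N *v D y" using ex by blast
  then have N: "D (\<i> *s y) = N *v D y" for y by (simp add: mat_imaginary_unit)
  have "D (\<i> *s y) = - (\<i> *s D y)" for y
  proof -
    have m: "D (- z) = - D z" for z using D(1) by (rule linear_neg)
    \<comment> \<open>Since \<open>N\<close> squares to minus the identity on the range of
      \<open>D\<close>, the right-hand side is twice the projection of \<open>D y\<close> to the
      eigenspace of \<open>N\<close> for \<open>\<i>\<close>. In this case that eigenspace is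
      trivial, so \<open>z\<close> must vanish.\<close>
    obtain z where z: "D z = D y - \<i> *s D (\<i> *s y)" using D(2) by (metis surjD)
    have "D (\<i> *s z) = N *v D y - \<i> *s (N *v D (\<i> *s y))"
      by (simp add: N[of z] z matrix_vector_mult_diff_distrib vector_scalar_commute)
    also have "\<dots> = D (\<i> *s y) - \<i> *s D (- y)"
      by (simp add: N[symmetric] vector_smult_assoc)
    also have "\<dots> = \<i> *s D z"
      by (simp add: z m vector_smult_assoc vector_ssub_ldistrib)
    finally have "z = 0" using False by blast
    then have "D y = \<i> *s D (\<i> *s y)" using z D(1) by (simp add: linear_0)
    then show ?thesis by (simp add: vector_smult_assoc)
  qed
  then show ?thesis by blast
qed

text \<open>Multiplication by \<open>c\<close> is a real combination of the identity and
  multiplication by \<open>\<i>\<close>, so commuting with the latter gives full complex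
  linearity.\<close>

lemma complex_linear_eq_matrix:
  fixes D :: "complex^'n \<Rightarrow> complex^'m"
  assumes D: "linear D" and i: "\<And>y. D (\<i> *s y) = \<i> *s D y"
  shows "\<exists>M. D = (*v) M"
proof -
  have "D (c *s y) = c *s D y" for c y
  proof -
    have split: "c *s v = Re c *\<^sub>R v + Im c *\<^sub>R (\<i> *s v)" for v :: "complex^'k"
      unfolding vec_eq_iff
      by (simp add: complex_eq_iff algebra_simps)
    show ?thesis by (simp only: split linear_add[OF D] linear_scale[OF D] i)
  qed
  then have "Vector_Spaces.linear (*s) (*s) D"
    by (simp add: Vector_Spaces.linear_iff linear_add[OF D] vec.vector_space_axioms)
  then have "matrix D *v y = D y" for y by (rule matrix_works)
  then show ?thesis by (metis ext)
qed

section \<open>Coordinatewise complex conjugation\<close>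

lemma bounded_linear_cnjv: "bounded_linear (cnjv :: complex^'n \<Rightarrow> complex^'n)"
  unfolding linear_conv_bounded_linear[symmetric]
  by (rule linearI) (simp_all add: cnjv_def vec_eq_iff)

lemma cnjv_cnjv [simp]: "cnjv (cnjv z) = z"
  by (simp add: cnjv_def vec_eq_iff)

lemma cnjv_scalar_mult: "cnjv (c *s z) = cnj c *s cnjv z"
  by (simp add: cnjv_def vec_eq_iff)

text \<open>The two conjugations replace the derivative matrix by its entrywise conjugate. Thus the
  hypothesis on \<open>psi\<close> passes to \<open>psi \<circ> cnjv\<close>.\<close>

lemma holo_on_cnjv_conjugate:
  fixes f :: "complex^'n \<Rightarrow> complex^'m"
  assumes "holo_on f UNIV"
  shows "holo_on (\<lambda>z. cnjv (f (cnjv z))) UNIV"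
  unfolding holo_on_def
proof
  fix x :: "complex^'n"
  obtain B where B: "(f has_derivative (\<lambda>v. B *v v)) (at (cnjv x))"
    using holo_onD[OF assms UNIV_I] .
  have "((\<lambda>z. f (cnjv z)) has_derivative (\<lambda>v. B *v cnjv v)) (at x)"
    using has_derivative_compose[OF bounded_linear_imp_has_derivative[OF bounded_linear_cnjv] B] .
  then have "((\<lambda>z. cnjv (f (cnjv z))) has_derivative (\<lambda>v. cnjv (B *v cnjv v))) (at x)"
    by (rule bounded_linear.has_derivative[OF bounded_linear_cnjv])
  also have "(\<lambda>v. cnjv (B *v cnjv v)) = (\<lambda>v. (\<chi> i j. cnj (B $ i $ j)) *v v)"
    by (simp add: cnjv_def matrix_vector_mult_def fun_eq_iff)
  finally show "\<exists>M. ((\<lambda>z. cnjv (f (cnjv z))) has_derivative (\<lambda>v. M *v v)) (at x)" by blast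
qed

subsection \<open>The derivative of the conjugating bijection\<close>

context holo_conjugation
begin

lemma open_psi_vimage_chart: "c \<in> A \<Longrightarrow> open (psi -` fst c)"
  using openin_continuous_map_preimage[OF continuous_map_psi openin_chart, of c]
  by (simp add: vimage_def)

lemma continuous_on_chart_psi: "c \<in> A \<Longrightarrow> continuous_on (psi -` fst c) (\<lambda>z. snd c (psi z))"
  using continuous_map_compose_chart[of c "top_of_set (psi -` fst c)" psi]
    continuous_map_from_subtopology[OF continuous_map_psi] by auto

lemma continuous_on_phi_cinv: "c \<in> A \<Longrightarrow> continuous_on (crange c) (\<lambda>x. phi (cinv c x))"
  using continuous_map_compose[OF continuous_map_cinv[OF _ order_refl] continuous_map_phi, of c]
  by (simp add: o_def)

lemma psi_phi_cinv: "c \<in> A \<Longrightarrow> x \<in> crange c \<Longrightarrow> psi (phi (cinv c x)) = cinv c x"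
  using cinv_in chart_subset psi_phi by blast

lemma phi_cinv_chart_psi: "c \<in> A \<Longrightarrow> psi z \<in> fst c \<Longrightarrow> phi (cinv c (snd c (psi z))) = z"
  by (simp add: cinv_chart)

lemma holo_on_conjugate_in_charts:
  assumes f: "holo_on f UNIV" and c: "c \<in> A" and d: "d \<in> A"
  shows "holo_on (\<lambda>x. snd d (psi (f (phi (cinv c x))))) {x \<in> crange c. psi (f (phi (cinv c x))) \<in> fst d}"
proof -
  have "holo_on (\<lambda>x. snd d (psi (f (phi (cinv c x)))))
     (snd c ` (fst c \<inter> {p \<in> topspace T. cj f p \<in> fst d}))"
    using holo_self_cj[OF f] c d unfolding holo_self_def cj_def cinv_def by blast
  then show ?thesis
    by (rule holo_on_subset) (use cinv_chart[OF c] chart_subset[OF c] in \<open>force simp: cj_def\<close>)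
qed

lemma conjugate_in_charts_derivative:
  assumes "holo_on f UNIV" "c \<in> A" "d \<in> A" "psi z \<in> fst c" "psi (f z) \<in> fst d"
  obtains M :: "complex^'m^'m"
  where "((\<lambda>x. snd d (psi (f (phi (cinv c x))))) has_derivative (\<lambda>v. M *v v)) (at (snd c (psi z)))"
  by (rule holo_onD[OF holo_on_conjugate_in_charts[OF assms(1-3)], of "snd c (psi z)"])
     (use assms in \<open>auto simp: phi_cinv_chart_psi\<close>)

end

text \<open>A single chart around \<open>psi 0\<close> is fixed: conjugated translations carry the
  derivative found there to every other point.\<close>

locale holo_conjugation_at_base = holo_conjugation T A psi phi
  for T :: "'M topology" and A :: "('M set \<times> ('M \<Rightarrow> complex^'m)) set"
    and psi :: "complex^'n \<Rightarrow> 'M" and phi +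
  fixes c
  assumes c: "c \<in> A" and base: "psi 0 \<in> fst c"
begin

lemma differentiable_at_base: "\<exists>D. ((\<lambda>z. snd c (psi z)) has_derivative D) (at 0)"
proof (rule differentiable_if_conjugated_translations_holo)
  show "open (crange c)" "open (psi -` fst c)" "continuous_on (crange c) (\<lambda>x. phi (cinv c x))"
    "continuous_on (psi -` fst c) (\<lambda>z. snd c (psi z))"
    using c by (auto intro: open_crange open_psi_vimage_chart continuous_on_phi_cinv continuous_on_chart_psi)
  show "snd c (psi 0) \<in> crange c" "phi (cinv c (snd c (psi 0))) = 0"
    using base c by (auto simp: phi_cinv_chart_psi)
  show "phi (cinv c x) \<in> psi -` fst c" "snd c (psi (phi (cinv c x))) = x" if "x \<in> crange c" for x
    using that c by (simp_all add: psi_phi_cinv cinv_in chart_cinv)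
  show "phi (cinv c (snd c (psi b))) = b" if "b \<in> psi -` fst c" for b
    using that c by (simp add: phi_cinv_chart_psi)
  show "holo_on (\<lambda>x. snd c (psi (a + phi (cinv c x)))) {x \<in> crange c. a + phi (cinv c x) \<in> psi -` fst c}" for a
    using holo_on_conjugate_in_charts[OF holo_on_translation[of a UNIV] c c]
    by (simp add: add.commute)
qed

definition D where "D = (SOME D. ((\<lambda>z. snd c (psi z)) has_derivative D) (at 0))"

lemma D: "((\<lambda>z. snd c (psi z)) has_derivative D) (at 0)"
  unfolding D_def by (rule someI_ex[OF differentiable_at_base])

lemma linear_D: "linear D"
  using D has_derivative_bounded_linear linear_conv_bounded_linear by blast

text \<open>Near \<open>b\<close>, \<open>psi z\<close> is the conjugated translation by
  \<open>b\<close> applied to \<open>psi (z - b)\<close>; the chain rule puts a complex matrix after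
  \<open>D\<close>.\<close>

lemma derivative_in_chart:
  assumes d: "d \<in> A" "psi b \<in> fst d"
  obtains M :: "complex^'m^'m"
  where "((\<lambda>z. snd d (psi z)) has_derivative (\<lambda>v. M *v D v)) (at b)"
proof -
  have "psi (0 + b) \<in> fst d" using d(2) by simp
  then obtain M :: "complex^'m^'m"
    where M: "((\<lambda>x. snd d (psi (phi (cinv c x) + b))) has_derivative (\<lambda>v. M *v v)) (at (snd c (psi 0)))"
    using conjugate_in_charts_derivative[OF holo_on_translation[of b UNIV] c d(1) base] by blast
  have "((\<lambda>z. z - b) has_derivative (\<lambda>v. v)) (at b)" by (auto intro!: derivative_eq_intros)
  then have "((\<lambda>z. snd c (psi (z - b))) has_derivative D) (at b)"
    by (rule has_derivative_compose[where g = "\<lambda>z. snd c (psi z)"]) (simp add: D)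
  then have 1: "((\<lambda>z. snd d (psi (phi (cinv c (snd c (psi (z - b)))) + b)))
      has_derivative (\<lambda>v. M *v D v)) (at b)"
    by (rule has_derivative_compose) (simp add: M)
  have op: "open ((\<lambda>z. z - b) -` (psi -` fst c))"
    using open_psi_vimage_chart[OF c] by (rule open_vimage) (intro continuous_intros)
  have "((\<lambda>z. snd d (psi z)) has_derivative (\<lambda>v. M *v D v)) (at b)"
    by (rule has_derivative_transform_within_open[OF 1 op]) (use base c in \<open>auto simp: phi_cinv_chart_psi\<close>)
  then show thesis by (rule that)
qed

text \<open>\<open>psi\<close> after \<open>B\<close> equals the conjugate of \<open>B\<close> after
  \<open>psi\<close>, and this conjugate fixes \<open>psi 0\<close>. Differentiating both sides at
  \<open>0\<close> gives the identity.\<close>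

lemma D_intertwines: "\<exists>M. \<forall>y. D (B *v y) = M *v D y"
proof -
  have B0: "B *v 0 = 0" by simp
  then have "psi (B *v 0) \<in> fst c" using base by simp
  then obtain M :: "complex^'m^'m"
    where M: "((\<lambda>x. snd c (psi (B *v phi (cinv c x)))) has_derivative (\<lambda>v. M *v v)) (at (snd c (psi 0)))"
    using conjugate_in_charts_derivative[OF holo_on_matrix[of B UNIV] c c base] by blast
  have "((\<lambda>z. snd c (psi (B *v phi (cinv c (snd c (psi z)))))) has_derivative (\<lambda>v. M *v D v)) (at 0)"
    using has_derivative_compose[OF D M] .
  then have 1: "((\<lambda>z. snd c (psi (B *v z))) has_derivative (\<lambda>v. M *v D v)) (at 0)"
    by (rule has_derivative_transform_within_open[OF _ open_psi_vimage_chart[OF c]])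
       (use base c in \<open>auto simp: phi_cinv_chart_psi\<close>)
  have "((\<lambda>z. B *v z) has_derivative (\<lambda>v. B *v v)) (at 0)"
    using linear_matrix_vector_mult_complex[of B]
    by (simp add: bounded_linear_imp_has_derivative linear_conv_bounded_linear)
  then have "((\<lambda>z. snd c (psi (B *v z))) has_derivative (\<lambda>v. D (B *v v))) (at 0)"
    by (rule has_derivative_compose[where g = "\<lambda>z. snd c (psi z)"]) (simp add: D)
  then have "(\<lambda>v. D (B *v v)) = (\<lambda>v. M *v D v)" using 1 by (rule has_derivative_unique)
  then show ?thesis by metis
qed

text \<open>If \<open>D\<close> were zero, \<open>derivative_in_chart\<close> would make the
  derivative vanish on a whole ball, so \<open>psi\<close> would be constant there, against
  injectivity.\<close>

lemma D_nonzero: "\<exists>y. D y \<noteq> 0"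
proof (rule ccontr)
  assume "\<not> ?thesis"
  then have D0: "D y = 0" for y by blast
  obtain r where r: "r > 0" "ball 0 r \<subseteq> psi -` fst c"
    using open_psi_vimage_chart[OF c] base open_contains_ball by blast
  have "((\<lambda>z. snd c (psi z)) has_derivative (\<lambda>_. 0)) (at b within ball 0 r)" if b: "b \<in> ball 0 r" for b
  proof -
    have "psi b \<in> fst c" using b r(2) by blast
    then obtain M :: "complex^'m^'m" where "((\<lambda>z. snd c (psi z)) has_derivative (\<lambda>v. M *v D v)) (at b)"
      by (rule derivative_in_chart[OF c])
    then show ?thesis by (simp add: D0 has_derivative_at_withinI)
  qed
  from has_derivative_zero_constant[OF convex_ball this]
  obtain k where k: "\<forall>z\<in>ball 0 r. snd c (psi z) = k" ..
  obtain b :: "complex^'n" where b: "norm b = r / 2"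
    using r(1) vector_choose_size[of "r / 2"] by auto
  then have in_ball: "b \<in> ball 0 r" "0 \<in> ball (0 :: complex^'n) r" using r(1) by auto
  then have "snd c (psi b) = snd c (psi 0)" using k by simp
  moreover have "psi b \<in> fst c" using in_ball(1) r(2) by blast
  ultimately have "b = 0" using phi_cinv_chart_psi[OF c] base by metis
  then show False using b r(1) by simp
qed

text \<open>By \<open>D_intertwines\<close> the kernel of \<open>D\<close> is invariant under all
  matrices, so one nonzero element would make it everything.\<close>

lemma inj_D: "inj D"
  unfolding linear_injective_0[OF linear_D]
proof (intro allI impI, rule ccontr)
  fix y assume y: "D y = 0" "y \<noteq> 0"
  have "D w = 0" for w
  proof -
    obtain B :: "complex^'n^'n" where "B *v y = w" using matrix_maps_to[OF y(2)] .
    moreover obtain M where "\<And>y. D (B *v y) = M *v D y" using D_intertwines by blast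
    ultimately show ?thesis using y(1) by (metis matrix_vector_mult_0_right)
  qed
  then show False using D_nonzero by blast
qed

text \<open>In a chart \<open>phi\<close> is a continuous injection of a nonempty open set, so
  invariance of dimension bounds the dimension of the manifold by that of \<open>complex^'n\<close>,
  which is the rank of the injective \<open>D\<close>.\<close>

lemma surj_D: "surj D"
proof -
  have "dim (UNIV :: (complex^'m) set) \<le> dim (UNIV :: (complex^'n) set)"
  proof (rule invariance_of_dimension_subspaces)
    show "openin (top_of_set UNIV) (crange c)" using open_crange[OF c] by simp
    show "continuous_on (crange c) (\<lambda>x. phi (cinv c x))" by (rule continuous_on_phi_cinv[OF c])
    show "inj_on (\<lambda>x. phi (cinv c x)) (crange c)"
      by (rule inj_onI) (metis c chart_cinv psi_phi_cinv)
    show "crange c \<noteq> {}" using base by blast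
  qed auto
  moreover have "dim (range D) = dim (UNIV :: (complex^'n) set)"
    using linear_D inj_D by (intro dim_image_eq) auto
  ultimately have "dim (range D) = DIM(complex^'m)"
    using dim_subset_UNIV[of "range D"] by simp
  then have "span (range D) = UNIV" unfolding dim_eq_full .
  then show ?thesis
    using linear_subspace_image[OF linear_D subspace_UNIV] span_eq_iff by metis
qed

definition Di where "Di = inv D"

lemma Di_D: "Di (D y) = y" and D_Di: "D (Di x) = x"
  unfolding Di_def using inj_D surj_D by (simp_all add: surj_f_inv_f)

lemma linear_Di: "linear Di"
  by (rule linearI) (metis D_Di Di_D linear_add[OF linear_D], metis D_Di Di_D linear_scale[OF linear_D])

lemma inverse_derivative_at_base:
  "((\<lambda>x. phi (cinv c x)) has_derivative Di) (at (snd c (psi 0)))"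
proof (rule has_derivative_inverse_basic)
  have x: "snd c (psi 0) \<in> crange c" using base by blast
  show "((\<lambda>z. snd c (psi z)) has_derivative D) (at (phi (cinv c (snd c (psi 0)))))"
    using D base c by (simp add: phi_cinv_chart_psi)
  show "bounded_linear Di" using linear_Di linear_conv_bounded_linear by blast
  show "Di \<circ> D = id" by (simp add: fun_eq_iff Di_D)
  show "continuous (at (snd c (psi 0))) (\<lambda>x. phi (cinv c x))"
    using continuous_on_phi_cinv[OF c] open_crange[OF c] x continuous_on_eq_continuous_at by blast
  show "open (crange c)" by (rule open_crange[OF c])
  show "snd c (psi 0) \<in> crange c" by (rule x)
  show "snd c (psi (phi (cinv c z))) = z" if "z \<in> crange c" for z
    using that c by (simp add: psi_phi_cinv chart_cinv)
qed

text \<open>The counterpart of \<open>derivative_in_chart\<close>: the conjugated translation by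
  \<open>- b\<close> moves the point to \<open>psi 0\<close>, where \<open>phi\<close> has
  derivative \<open>Di\<close>, and adding \<open>b\<close> undoes the shift.\<close>

lemma inverse_derivative_in_chart:
  assumes d: "d \<in> A" and x: "x \<in> crange d"
  obtains M :: "complex^'m^'m"
  where "((\<lambda>x. phi (cinv d x)) has_derivative (\<lambda>v. Di (M *v v))) (at x)"
proof -
  define b where "b = phi (cinv d x)"
  have psib: "psi b = cinv d x" unfolding b_def by (rule psi_phi_cinv[OF d x])
  then have bd: "psi b \<in> fst d" and xb: "snd d (psi b) = x"
    using cinv_in[OF d x] chart_cinv[OF d x] by simp_all
  have "psi (b + - b) \<in> fst c" using base by simp
  then obtain M :: "complex^'m^'m"
    where M: "((\<lambda>x. snd c (psi (phi (cinv d x) + - b))) has_derivative (\<lambda>v. M *v v)) (at x)"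
    using conjugate_in_charts_derivative[OF holo_on_translation[of "- b" UNIV] d c bd] xb by metis
  have "((\<lambda>x. phi (cinv c (snd c (psi (phi (cinv d x) + - b))))) has_derivative (\<lambda>v. Di (M *v v))) (at x)"
    by (rule has_derivative_compose[OF M]) (use inverse_derivative_at_base in \<open>simp add: b_def\<close>)
  then have 1: "((\<lambda>x. b + phi (cinv c (snd c (psi (phi (cinv d x) + - b))))) has_derivative (\<lambda>v. Di (M *v v))) (at x)"
    by (auto intro!: derivative_eq_intros)
  have contd: "continuous_on (crange d) (\<lambda>x. phi (cinv d x) + - b)"
    by (intro continuous_intros continuous_on_phi_cinv d)
  have op: "open (crange d \<inter> (\<lambda>x. phi (cinv d x) + - b) -` (psi -` fst c))"
    using continuous_open_preimage[OF contd open_crange[OF d] open_psi_vimage_chart[OF c]] .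
  have "((\<lambda>x. phi (cinv d x)) has_derivative (\<lambda>v. Di (M *v v))) (at x)"
    by (rule has_derivative_transform_within_open[OF 1 op])
       (use x base c in \<open>auto simp: phi_cinv_chart_psi b_def[symmetric]\<close>)
  then show thesis by (rule that)
qed

section \<open>Biholomorphy when the derivative at the base point is complex linear\<close>

lemma inv_into_psi: "p \<in> topspace T \<Longrightarrow> inv_into UNIV psi p = phi p"
  by (metis inv_f_f inj_def phi_psi psi_phi)

text \<open>In charts every derivative of \<open>psi\<close> is a matrix after \<open>D\<close>, and
  every derivative of \<open>phi\<close> is \<open>Di\<close> after a matrix. All are complex
  matrices once \<open>D\<close> is, since \<open>Di\<close> inherits complex linearity.\<close>

lemma biholo_if_D_complex_linear:
  assumes lin: "\<And>y. D (\<i> *s y) = \<i> *s D y"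
  shows "biholo T A psi"
proof -
  obtain P where P: "D = (*v) P"
    using complex_linear_eq_matrix[OF linear_D lin] by blast
  have "Di (\<i> *s y) = \<i> *s Di y" for y by (metis D_Di Di_D lin)
  then obtain Q where Q: "Di = (*v) Q"
    using complex_linear_eq_matrix[OF linear_Di] by blast
  have "bij_betw psi UNIV (topspace T)"
    by (rule bij_betw_byWitness[where f' = phi]) auto
  moreover have "holo_to T A psi"
    unfolding holo_to_def
  proof (intro conjI ballI continuous_map_psi)
    fix d assume d: "d \<in> A"
    show "holo_on (\<lambda>z. snd d (psi z)) (psi -` fst d)"
      unfolding holo_on_def
    proof
      fix b assume "b \<in> psi -` fst d"
      then obtain M where "((\<lambda>z. snd d (psi z)) has_derivative (\<lambda>v. M *v D v)) (at b)"
        using derivative_in_chart[OF d] by blast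
      then show "\<exists>B. ((\<lambda>z. snd d (psi z)) has_derivative (\<lambda>v. B *v v)) (at b)"
        by (auto simp: P matrix_vector_mul_assoc)
    qed
  qed
  moreover have "holo_from T A (inv_into UNIV psi)"
    unfolding holo_from_def
  proof (intro conjI ballI)
    show "continuous_map T euclidean (inv_into UNIV psi)"
      by (rule continuous_map_eq[OF continuous_map_phi]) (simp add: inv_into_psi)
    fix d assume d: "d \<in> A"
    show "holo_on (\<lambda>x. inv_into UNIV psi (inv_into (fst d) (snd d) x)) (crange d)"
      unfolding holo_on_def cinv_def[symmetric]
    proof
      fix x assume x: "x \<in> crange d"
      obtain M where M: "((\<lambda>x. phi (cinv d x)) has_derivative (\<lambda>v. Di (M *v v))) (at x)"
        using inverse_derivative_in_chart[OF d x] .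
      have "((\<lambda>x. inv_into UNIV psi (cinv d x)) has_derivative (\<lambda>v. Di (M *v v))) (at x)"
        by (rule has_derivative_transform_within_open[OF M open_crange[OF d] x])
           (use cinv_in[OF d] chart_subset[OF d] inv_into_psi in fastforce)
      then show "\<exists>B. ((\<lambda>x. inv_into UNIV psi (cinv d x)) has_derivative (\<lambda>v. B *v v)) (at x)"
        by (auto simp: Q matrix_vector_mul_assoc)
    qed
  qed
  ultimately show ?thesis unfolding biholo_def by blast
qed

end

theorem theorem1:
  fixes T :: "'M topology"
    and A :: "('M set \<times> ('M \<Rightarrow> complex^'m)) set"
    and psi :: "complex^'n \<Rightarrow> 'M"
  assumes "CARD('n) \<ge> 2"
    and "complex_manifold T A"
    and "bij_betw psi UNIV (topspace T)"
    and "\<forall>f :: complex^'n \<Rightarrow> complex^'n. holo_on f UNIV \<longrightarrow>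
           holo_self T A (psi \<circ> f \<circ> inv_into UNIV psi)"
  shows "biholo T A psi \<or> antibiholo T A psi"
proof -
  define phi where "phi = inv_into UNIV psi"
  have psi_in: "psi z \<in> topspace T" and phi_psi: "phi (psi z) = z"
    and psi_phi: "p \<in> topspace T \<Longrightarrow> psi (phi p) = p" for z p
    using assms(3) unfolding bij_betw_def phi_def by (auto simp: f_inv_into_f)
  have conj: "holo_self T A (\<lambda>p. psi (f (phi p)))" if "holo_on f UNIV" for f
    using assms(4) that by (simp add: o_def phi_def)
  obtain c where c: "c \<in> A" "psi 0 \<in> fst c"
    using psi_in[of 0] assms(2) unfolding complex_manifold_def by blast
  have zero: "cnjv (0 :: complex^'n) = 0" by (simp add: cnjv_def vec_eq_iff)
  interpret holo_conjugation_at_base T A psi phi c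
    by unfold_locales (use assms(2) psi_in phi_psi psi_phi conj c in auto)
  \<comment> \<open>Precomposing with conjugation gives another instance in the same chart, so the
    antilinear case reduces to the linear one.\<close>
  interpret bar: holo_conjugation_at_base T A "psi \<circ> cnjv" "cnjv \<circ> phi" c
  proof unfold_locales
    show "holo_self T A (\<lambda>p. (psi \<circ> cnjv) (f ((cnjv \<circ> phi) p)))" if "holo_on f UNIV" for f
      using conj[OF holo_on_cnjv_conjugate[OF that]] by simp
    show "(psi \<circ> cnjv) 0 \<in> fst c"
      using base by (simp add: zero)
  qed (use c psi_in phi_psi psi_phi in auto)
  have "((\<lambda>z. snd c (psi (cnjv z))) has_derivative (\<lambda>v. D (cnjv v))) (at 0)"
    using has_derivative_compose[OF bounded_linear_imp_has_derivative[OF bounded_linear_cnjv],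
        where g = "\<lambda>z. snd c (psi z)" and g' = D] D by (simp add: zero)
  \<comment> \<open>Uniqueness of derivatives identifies the chosen \<open>bar.D\<close>, which is
    complex linear exactly when \<open>D\<close> is antilinear.\<close>
  then have barD: "bar.D = (\<lambda>v. D (cnjv v))"
    using bar.D by (auto simp: o_def intro: has_derivative_unique)
  from complex_linear_or_antilinear[OF linear_D surj_D D_intertwines] show ?thesis
  proof
    assume "\<forall>y. D (\<i> *s y) = \<i> *s D y"
    then show ?thesis using biholo_if_D_complex_linear by blast
  next
    assume anti: "\<forall>y. D (\<i> *s y) = - (\<i> *s D y)"
    have "bar.D (\<i> *s y) = \<i> *s bar.D y" for y
    proof -
      have "bar.D (\<i> *s y) = D (- (\<i> *s cnjv y))" by (simp add: barD cnjv_scalar_mult)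
      also have "\<dots> = \<i> *s bar.D y" using anti by (simp add: linear_neg[OF linear_D] barD)
      finally show ?thesis .
    qed
    then show ?thesis using bar.biholo_if_D_complex_linear by (simp add: antibiholo_def)
  qed
qed

end
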